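(* Let $n>2$ be an integer, $G_n=(\mathbb{Z}/n\mathbb{Z})^*$, and let $\mathbb{C}[G_n]$ be the group algebra with basis $\{\sigma_g:g\in G_n\}$. For $x\in\tfrac1n\mathbb{Z}/\mathbb{Z}$ let $S(x)=\sum_{g\in G_n}B_1(gx)\sigma_g\in\mathbb{C}[G_n]$, let $U\subset\mathbb{C}[G_n]$ be the complex span of $\{S(x):x\in\tfrac1n\mathbb{Z}/\mathbb{Z}\}$, and let $U^\perp=\{f\in\mathbb{C}[G_n]^*:f(u)=0\ \forall u\in U\}$. Let $\{\sigma_g^*\}$ be the dual basis and $u_g^*=\sigma_g^*+\sigma_{-g}^*$. Then $\{u_g^*:g\in G_n\}$ is a basis of $U^\perp$. In particular $\dim_{\mathbb{C}}U^\perp=\dim_{\mathbb{C}}U=\varphi(n)/2$.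
   Context: $B_1$ is the periodic first Bernoulli function: $B_1(x)=\{x\}-\tfrac12$ for $x\notin\mathbb{Z}$, $B_1(x)=0$ for $x\in\mathbb{Z}$; $B_1(gx)$ is well defined for $g\in G_n$, $x\in\tfrac1n\mathbb{Z}/\mathbb{Z}$ by choosing representatives. $\varphi$ is Euler's totient function. Note $u_g^*=u_{-g}^*$, so the set $\{u_g^*\}$ has $\varphi(n)/2$ elements. *)

theory Defs
  imports Complex_Main "HOL-Number_Theory.Number_Theory" "HOL-Library.Function_Algebras"
begin

definition cscale :: "complex \<Rightarrow> ('a \<Rightarrow> complex) \<Rightarrow> 'a \<Rightarrow> complex" where
  "cscale c f = (\<lambda>x. c * f x)"

text \<open>
  The interpretation is used at two types: \<^typ>\<open>int \<Rightarrow> complex\<close> (elements of the group algebra)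
  and \<^typ>\<open>(int \<Rightarrow> complex) \<Rightarrow> complex\<close> (linear functionals on it).
\<close>

interpretation cfun: vector_space cscale
  by unfold_locales (auto simp: cscale_def fun_eq_iff algebra_simps)

definition unit_group :: "nat \<Rightarrow> int set" where
  "unit_group n = Units (residue_ring (int n))"

text \<open>
  An element of the group algebra is its coefficient function, extended by 0 outside
  the group; only the vector space structure is needed.
\<close>

definition group_algebra :: "nat \<Rightarrow> (int \<Rightarrow> complex) set" where
  "group_algebra n = {a. \<forall>g. g \<notin> unit_group n \<longrightarrow> a g = 0}"

definition sigma :: "int \<Rightarrow> int \<Rightarrow> complex" where
  "sigma g = (\<lambda>h. if h = g then 1 else 0)"

definition bernoulli1 :: "real \<Rightarrow> real" where
  "bernoulli1 x = (if x \<in> \<int> then 0 else frac x - 1 / 2)"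

text \<open>
  Classes in \<open>(1/n)\<int>/\<int>\<close> are given by real representatives; independence of the representatives
  is \<open>bernoulli1_well_defined\<close> and \<open>stickelberger_well_defined\<close> below.
\<close>

definition frac_multiples :: "nat \<Rightarrow> real set" where
  "frac_multiples n = {of_int k / of_nat n |k::int. True}"

definition stickelberger :: "nat \<Rightarrow> real \<Rightarrow> int \<Rightarrow> complex" where
  "stickelberger n x =
     (\<Sum>g\<in>unit_group n. cscale (complex_of_real (bernoulli1 (of_int g * x))) (sigma g))"

definition stickelberger_span :: "nat \<Rightarrow> (int \<Rightarrow> complex) set" where
  "stickelberger_span n = cfun.span (stickelberger n ` frac_multiples n)"

text \<open>
  A functional on the group algebra is extended by 0 to the whole type, so that equality of
  functionals is equality on the group algebra.
\<close>

definition dual_space :: "nat \<Rightarrow> ((int \<Rightarrow> complex) \<Rightarrow> complex) set" where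
  "dual_space n = {f.
     (\<forall>a\<in>group_algebra n. \<forall>b\<in>group_algebra n. f (a + b) = f a + f b) \<and>
     (\<forall>c. \<forall>a\<in>group_algebra n. f (cscale c a) = c * f a) \<and>
     (\<forall>a. a \<notin> group_algebra n \<longrightarrow> f a = 0)}"

definition annihilator :: "nat \<Rightarrow> (int \<Rightarrow> complex) set \<Rightarrow> ((int \<Rightarrow> complex) \<Rightarrow> complex) set" where
  "annihilator n V = {f \<in> dual_space n. \<forall>v\<in>V. f v = 0}"

definition sigma_dual :: "nat \<Rightarrow> int \<Rightarrow> (int \<Rightarrow> complex) \<Rightarrow> complex" where
  "sigma_dual n g = (\<lambda>a. if a \<in> group_algebra n then a g else 0)"

definition u_dual :: "nat \<Rightarrow> int \<Rightarrow> (int \<Rightarrow> complex) \<Rightarrow> complex" where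
  "u_dual n g = sigma_dual n g + sigma_dual n (\<ominus>\<^bsub>residue_ring (int n)\<^esub> g)"

lemma bernoulli1_add_Ints:
  assumes "z \<in> \<int>"
  shows "bernoulli1 (x + z) = bernoulli1 x"
proof -
  have "x + z \<in> \<int> \<longleftrightarrow> x \<in> \<int>"
    using assms by (metis Ints_add Ints_diff add_diff_cancel_right')
  moreover have "frac (x + z) = frac x"
    using assms by (auto simp: frac_def elim!: Ints_cases)
  ultimately show ?thesis
    by (simp add: bernoulli1_def)
qed

lemma bernoulli1_well_defined:
  assumes "n > 0" and x: "x \<in> frac_multiples n" and "x - y \<in> \<int>" and "[g = h] (mod int n)"
  shows "bernoulli1 (of_int g * x) = bernoulli1 (of_int h * y)"
proof -
  obtain k :: int where k: "x = of_int k / of_nat n"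
    using x by (auto simp: frac_multiples_def)
  obtain j where j: "g = h + int n * j"
    using assms(4) by (metis cong_iff_lin cong_sym)
  have "of_int g * x = of_int h * y + (of_int h * (x - y) + of_int (j * k))"
    using \<open>n > 0\<close> by (simp add: j k field_simps)
  moreover have "of_int h * (x - y) + of_int (j * k) \<in> \<int>"
    using assms(3) by (intro Ints_add Ints_mult) auto
  ultimately show ?thesis
    by (simp only: bernoulli1_add_Ints)
qed

lemma stickelberger_well_defined:
  assumes "n > 0" "x \<in> frac_multiples n" "x - y \<in> \<int>"
  shows "stickelberger n x = stickelberger n y"
  unfolding stickelberger_def
  using bernoulli1_well_defined[OF assms cong_refl] by simp

lemma sigma_in_group_algebra: "g \<in> unit_group n \<Longrightarrow> sigma g \<in> group_algebra n"
  by (auto simp: sigma_def group_algebra_def)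

lemma sigma_dual_in_dual_space: "sigma_dual n g \<in> dual_space n"
  by (auto simp: sigma_dual_def dual_space_def group_algebra_def cscale_def)

lemma sigma_dual_sigma:
  "h \<in> unit_group n \<Longrightarrow> sigma_dual n g (sigma h) = (if g = h then 1 else 0)"
  using sigma_in_group_algebra[of h n] by (simp add: sigma_dual_def sigma_def)

end

theory Submission
  imports Defs "HOL-Analysis.Gamma_Function"
begin

text \<open>
  Since \<open>B\<^sub>1\<close> is odd, every \<open>S(x)\<close> lies in the odd part of the group algebra, and the theorem
  says that these elements span it. Otherwise the odd functions \<open>f\<close> on \<open>G\<^sub>n\<close> with
  \<open>\<Sum>\<^sub>g f(g) B\<^sub>1(gx) = 0\<close> for all \<open>x\<close> form a non-zero translation-invariant space, which then
  contains an odd character \<open>\<chi>\<close>. The sine transform of \<open>B\<^sub>1\<close> on \<open>(1/n)\<int>/\<int>\<close> is a cotangent,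
  so the relations for \<open>\<chi>\<close> give \<open>\<Sum>\<^sub>a \<chi>\<^sup>-\<^sup>1(a) cot(\<pi>a/n) = 0\<close>, that is \<open>L(1, \<chi>\<^sup>-\<^sup>1) = 0\<close>,
  contradicting Dirichlet's non-vanishing theorem. The latter is proved by Monsky's Lambert series
  argument for real characters and by the 3-4-1 inequality for the others.
\<close>

subsection \<open>Summation by parts\<close>

text \<open>The relations at x = 1/n alone would not do. If chi modulo n is induced by a primitive
  character psi, the sum of chi(g) B_1(g/n) is the corresponding sum for psi times the product of 1
  - psi(p) over the primes p dividing n, and this product may vanish. Weighting the relations at all
  k/n by sin(2 pi k/n) leads instead to L(1) of the conjugate character modulo n, where the extra
  factors have the form 1 - psi(p)/p up to conjugation and cannot vanish. So neither a reduction to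
  primitive characters nor Gauss sums are required. The two non-vanishing arguments complement each
  other. The 3-4-1 inequality plays a fourfold zero against the triple pole of zeta(s)^3; for real
  chi the square is principal and contributes a fourth pole, so nothing is gained. The Lambert
  series argument needs nonnegative divisor sums and is therefore confined to real chi. On the
  linear side, the annihilator of U is determined before U itself; U is then recovered from it by a
  separating functional.\<close>

lemma norm_sum_mult_le_variation:
  fixes a :: "nat \<Rightarrow> complex" and b :: "nat \<Rightarrow> real"
  assumes bound: "\<And>N. norm (\<Sum>m<N. a m) \<le> C"
  shows "norm (\<Sum>m<N. a m * of_real (b m)) \<le> C * (\<bar>b N\<bar> + (\<Sum>m<N. \<bar>b m - b (Suc m)\<bar>))"
proof -
  define A where "A N = (\<Sum>m<N. a m)" for N
  have C0: "C \<ge> 0"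
    using bound[of 0] by simp
  have "(\<Sum>m<N. a m * of_real (b m)) =
      A N * of_real (b N) + (\<Sum>m<N. A (Suc m) * of_real (b m - b (Suc m)))"
    by (induction N) (simp_all add: A_def algebra_simps)
  also have "norm \<dots> \<le> norm (A N) * \<bar>b N\<bar> + (\<Sum>m<N. norm (A (Suc m)) * \<bar>b m - b (Suc m)\<bar>)"
    by (rule norm_triangle_le, intro add_mono sum_norm_le)
       (simp_all only: norm_mult norm_of_real order_refl)
  also have "\<dots> \<le> C * \<bar>b N\<bar> + (\<Sum>m<N. C * \<bar>b m - b (Suc m)\<bar>)"
    by (intro add_mono sum_mono mult_right_mono) (simp_all only: A_def bound abs_ge_zero)
  finally show ?thesis
    by (simp add: algebra_simps sum_distrib_left)
qed

text \<open>For decreasing weights the variation telescopes to \<open>b 0 - b N\<close>, which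
  together with the boundary term leaves \<open>b 0\<close>. The general form is kept for the
  weights 1/m - 1/m^s, which are not monotone.\<close>

lemma norm_sum_mult_antimono_le:
  fixes a :: "nat \<Rightarrow> complex" and b :: "nat \<Rightarrow> real"
  assumes "\<And>N. norm (\<Sum>m<N. a m) \<le> C" and "\<And>m. b (Suc m) \<le> b m" and "\<And>m. b m \<ge> 0"
  shows "norm (\<Sum>m<N. a m * of_real (b m)) \<le> C * b 0"
proof -
  have "(\<Sum>m<N. \<bar>b m - b (Suc m)\<bar>) = (\<Sum>m<N. b m - b (Suc m))"
    using assms(2) by (intro sum.cong) auto
  also have "\<dots> = b 0 - b N"
    by (induction N) auto
  finally show ?thesis
    using norm_sum_mult_le_variation[of a C b N, OF assms(1)] assms(3)[of N] by simp
qed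

text \<open>Dirichlet's test: the tail from \<open>m\<close> on is again a sum with bounded partial
  sums. These are differences of two initial ones, which doubles \<open>C\<close>.\<close>

lemma summable_mult_antimono:
  fixes a :: "nat \<Rightarrow> complex" and b :: "nat \<Rightarrow> real"
  assumes bound: "\<And>N. norm (\<Sum>m<N. a m) \<le> C" and dec: "\<And>m. b (Suc m) \<le> b m"
    and lim: "b \<longlonglongrightarrow> 0"
  shows "summable (\<lambda>m. a m * of_real (b m))"
proof (rule summable_Cauchy')
  have nonneg: "b m \<ge> 0" for m
    using decseq_ge[OF _ lim] dec by (simp add: decseq_SucI)
  have shift: "norm (\<Sum>i<N. a (m + i)) \<le> 2 * C" for m N
  proof -
    have "(\<Sum>i<m+N. a i) = (\<Sum>i<m. a i) + (\<Sum>i<N. a (m + i))"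
      by (induction N) (auto simp: algebra_simps)
    then have "(\<Sum>i<N. a (m + i)) = (\<Sum>i<m+N. a i) - (\<Sum>i<m. a i)"
      by simp
    then show ?thesis
      using norm_triangle_ineq4[of "\<Sum>i<m+N. a i" "\<Sum>i<m. a i"] bound[of "m+N"] bound[of m]
      by simp
  qed
  have "norm (\<Sum>i=m..<k. a i * of_real (b i)) \<le> 2 * C * b m" if "k \<ge> m" for m k
  proof -
    have "(\<Sum>i=m..<k. a i * of_real (b i)) = (\<Sum>i<k-m. a (m + i) * of_real (b (m + i)))"
      using that by (subst sum.atLeastLessThan_shift_0) (auto simp: atLeast0LessThan)
    also have "norm \<dots> \<le> 2 * C * b (m + 0)"
      by (rule norm_sum_mult_antimono_le) (use shift dec nonneg in auto)
    finally show ?thesis by simp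
  qed
  then show "\<forall>\<^sub>F m in sequentially. \<forall>k\<ge>m. norm (\<Sum>i=m..<k. a i * of_real (b i)) \<le> 2 * C * b m"
    by simp
  show "(\<lambda>m. 2 * C * b m) \<longlonglongrightarrow> 0"
    using tendsto_mult_right_zero[OF lim] by simp
qed

subsection \<open>Dirichlet characters\<close>

lemma bij_betw_mult_mod_residues:
  fixes b :: int
  assumes "coprime b (int n)" and "n > 0"
  shows "bij_betw (\<lambda>a. (a * b) mod int n) {0..<int n} {0..<int n}"
proof -
  have "inj_on (\<lambda>a. (a * b) mod int n) {0..<int n}"
  proof
    fix x y assume xy: "x \<in> {0..<int n}" "y \<in> {0..<int n}" "(x * b) mod int n = (y * b) mod int n"
    then have "[x * b = y * b] (mod int n)"
      by (simp add: Cong.cong_def)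
    then have "[x = y] (mod int n)"
      using assms(1) cong_mult_rcancel by blast
    then show "x = y"
      using xy by (auto simp: Cong.cong_def)
  qed
  moreover have "(\<lambda>a. (a * b) mod int n) ` {0..<int n} \<subseteq> {0..<int n}"
    using assms(2) by auto
  ultimately show ?thesis
    by (metis bij_betw_def endo_inj_surj finite_atLeastLessThan_int)
qed

text \<open>Characters of the unit group modulo \<open>n\<close>, extended by 0 to all integers.
  Sums may then run over whole intervals, and multiplicativity holds without coprimality conditions,
  as the Lambert series and the Euler product require.\<close>

locale dirichlet_character =
  fixes n :: nat and chi :: "int \<Rightarrow> complex"
  assumes n_gt_1: "n > 1"
    and one [simp]: "chi 1 = 1"
    and mult: "chi (a * b) = chi a * chi b"
    and periodic: "chi (a + int n) = chi a"
    and eq_0_iff: "chi a = 0 \<longleftrightarrow> \<not> coprime a (int n)"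
begin

lemma periodic_mult: "chi (a + int n * k) = chi a"
proof -
  have "chi (a + int n * int j) = chi a" for j a
  proof (induction j)
    case (Suc j)
    then show ?case
      using periodic[of "a + int n * int j"] by (simp add: algebra_simps)
  qed simp
  from this[of a "nat k"] this[of "a + int n * k" "nat (-k)"] show ?thesis
    by (cases "k \<ge> 0") auto
qed

lemma eq_if_cong: "[a = b] (mod int n) \<Longrightarrow> chi a = chi b"
  by (metis cong_iff_lin periodic_mult)

lemma mod_eq [simp]: "chi (a mod int n) = chi a"
  by (rule eq_if_cong) simp

lemma zero [simp]: "chi 0 = 0"
  using eq_0_iff n_gt_1 by simp

lemma power: "chi (a ^ k) = chi a ^ k"
  by (induction k) (auto simp: mult)

lemma norm_eq_1:
  assumes "coprime a (int n)"
  shows "norm (chi a) = 1"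
proof -
  define b where "b = nat (a mod int n)"
  have b: "int b = a mod int n"
    using n_gt_1 by (simp add: b_def)
  have "coprime (int b) (int n)"
    using assms n_gt_1 by (simp add: b)
  then have "[b ^ totient n = 1] (mod n)"
    by (intro euler_theorem) simp
  then have "[int b ^ totient n = 1] (mod int n)"
    by (metis cong_int_iff of_nat_1 of_nat_power)
  then have "chi (int b) ^ totient n = 1"
    using eq_if_cong by (simp flip: power)
  then have "norm (chi a) ^ totient n = 1"
    by (simp add: b flip: norm_power)
  then show ?thesis
    using n_gt_1 by (metis norm_ge_zero power_eq_1_iff totient_gt_0_iff
        zero_less_iff_neq_zero not_one_less_zero abs_of_nonneg real_norm_def)
qed

lemma norm_le_1: "norm (chi a) \<le> 1"
  using norm_eq_1[of a] eq_0_iff[of a] by (cases "coprime a (int n)") auto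

text \<open>Replacing \<open>a\<close> by \<open>a * b\<close> permutes the residues and multiplies
  the sum by \<open>chi b\<close>.\<close>

lemma sum_period_eq_0:
  assumes "coprime b (int n)" "chi b \<noteq> 1"
  shows "(\<Sum>m<n. chi (int m)) = 0"
proof -
  have "(\<Sum>m<n. chi (int m)) = (\<Sum>a\<in>{0..<int n}. chi a)"
    by (rule sum.reindex_bij_witness[of _ nat int]) auto
  moreover have "(\<Sum>a\<in>{0..<int n}. chi a) = (\<Sum>a\<in>{0..<int n}. chi ((a * b) mod int n))"
    using sum.reindex_bij_betw[OF bij_betw_mult_mod_residues[OF assms(1)], of chi] n_gt_1 by simp
  moreover have "\<dots> = (\<Sum>a\<in>{0..<int n}. chi a) * chi b"
    by (simp add: mult sum_distrib_right)
  ultimately have "(\<Sum>m<n. chi (int m)) * (1 - chi b) = 0"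
    by (simp add: algebra_simps)
  then show ?thesis
    using assms(2) by simp
qed

text \<open>Complete periods cancel, so at most \<open>n\<close> terms of norm at most 1 remain. The
  index \<open>Suc m\<close> fits the weights 1/(m+1); the shift is free because
  \<open>chi 0 = 0\<close>.\<close>

lemma norm_partial_sum_le:
  assumes "coprime b (int n)" "chi b \<noteq> 1"
  shows "norm (\<Sum>m<N. chi (int (Suc m))) \<le> real n"
proof -
  have *: "norm (\<Sum>m<N. chi (int m)) \<le> real n" for N
  proof (induction N rule: less_induct)
    case (less N)
    show ?case
    proof (cases "N \<le> n")
      case True
      have "norm (\<Sum>m<N. chi (int m)) \<le> (\<Sum>m<N. 1)"
        by (intro sum_norm_le norm_le_1)
      then show ?thesis using True by simp
    next
      case False
      define M where "M = N - n"
      have N: "N = n + M" using False by (simp add: M_def)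
      have "(\<Sum>m<n + M. chi (int m)) = (\<Sum>m<n. chi (int m)) + (\<Sum>m<M. chi (int m + int n))"
        by (induction M) (auto simp: algebra_simps)
      then have "(\<Sum>m<N. chi (int m)) = (\<Sum>m<M. chi (int m))"
        using sum_period_eq_0[OF assms] N by (simp add: periodic)
      then show ?thesis
        using less.IH[of M] n_gt_1 N by simp
    qed
  qed
  have "(\<Sum>m<Suc N. chi (int m)) = chi 0 + (\<Sum>m<N. chi (int (Suc m)))"
    by (subst sum.lessThan_Suc_shift) simp
  then show ?thesis
    using *[of "Suc N"] by simp
qed

lemma square: "dirichlet_character n (\<lambda>a. chi a ^ 2)"
  using n_gt_1 mult eq_0_iff periodic by unfold_locales (auto simp: power_mult_distrib)

lemma conj: "dirichlet_character n (\<lambda>a. cnj (chi a))"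
  using n_gt_1 mult eq_0_iff periodic by unfold_locales auto

lemma summable_L1:
  assumes "coprime b (int n)" "chi b \<noteq> 1"
  shows "summable (\<lambda>m. chi (int (Suc m)) / of_nat (Suc m))"
proof -
  have "summable (\<lambda>m. chi (int (Suc m)) * of_real (1 / real (Suc m)))"
    by (rule summable_mult_antimono[OF norm_partial_sum_le[OF assms]])
       (auto simp: field_simps intro: LIMSEQ_Suc[OF lim_1_over_n, simplified])
  then show ?thesis by simp
qed

end

text \<open>Unordered sums over \<open>{1..}\<close> serve for rearrangement, ordered series for
  summation by parts; this is the passage from the first to the second.\<close>

lemma has_sum_from_1_imp_sums:
  assumes "(f has_sum S) {1::nat..}"
  shows "(\<lambda>m. f (Suc m)) sums S"
proof -
  have "{1..} = range Suc"
    using Suc_le_D by force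
  then have "((f \<circ> Suc) has_sum S) UNIV"
    using assms by (simp add: has_sum_reindex)
  then show ?thesis
    by (auto dest: has_sum_imp_sums simp: o_def)
qed

subsection \<open>Divisor sums of real characters\<close>

lemma divisors_prime_power_mult:
  fixes p N :: nat
  assumes p: "prime p" "\<not> p dvd N"
  shows "{d. d dvd p ^ k * N} = (\<lambda>(i, d). p ^ i * d) ` ({..k} \<times> {d. d dvd N})"
    and "inj_on (\<lambda>(i, d). p ^ i * d) ({..k} \<times> {d. d dvd N})"
proof -
  show "{d. d dvd p ^ k * N} = (\<lambda>(i, d). p ^ i * d) ` ({..k} \<times> {d. d dvd N})"
  proof (intro equalityI subsetI)
    fix d assume "d \<in> {d. d dvd p ^ k * N}"
    then obtain x y where "d = x * y" "x dvd p ^ k" "y dvd N"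
      by (auto elim: dvd_productE)
    then show "d \<in> (\<lambda>(i, d). p ^ i * d) ` ({..k} \<times> {d. d dvd N})"
      using divides_primepow_nat[OF p(1)] by auto
  next
    fix d assume "d \<in> (\<lambda>(i, d). p ^ i * d) ` ({..k} \<times> {d. d dvd N})"
    then show "d \<in> {d. d dvd p ^ k * N}"
      by (auto intro!: mult_dvd_mono le_imp_power_dvd)
  qed
  have "i \<ge> j" if "p ^ i * d = p ^ j * e" "d dvd N" "e dvd N" for i j d e
  proof (rule ccontr)
    assume "\<not> i \<ge> j"
    then obtain l where l: "j = i + Suc l"
      using less_imp_Suc_add[of i j] by auto
    then have "d = p ^ Suc l * e"
      using that(1) p(1) by (auto simp: power_add prime_gt_0_nat)
    then show False
      using that(2) p(2) dvd_trans[of p d N] by simp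
  qed
  then have "i = j" if "p ^ i * d = p ^ j * e" "d dvd N" "e dvd N" for i j d e
    using that by (metis le_antisym)
  then have inj: "i = j \<and> d = e" if "p ^ i * d = p ^ j * e" "d dvd N" "e dvd N" for i j d e
    using that p(1) prime_gt_0_nat[of p] by (metis mult_cancel_left power_eq_0_iff less_irrefl)
  show "inj_on (\<lambda>(i, d). p ^ i * d) ({..k} \<times> {d. d dvd N})"
  proof (rule inj_onI, clarify)
    fix i d j e assume "d dvd N" "e dvd N" "p ^ i * d = p ^ j * e"
    then show "i = j \<and> d = e" by (rule inj[rotated 1])
  qed
qed

text \<open>This is the factor that a prime power p^k contributes to the divisor sum of a real
  character, with \<open>y\<close> the value at p. For \<open>y = -1\<close> it alternates between 1
  and 0, which is why even exponents, and hence squares, are singled out.\<close>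

lemma geometric_sum_sign_ge:
  assumes "y \<in> {-1, 0, 1::real}"
  shows "(\<Sum>i\<le>k. y ^ i) \<ge> (if even k then 1 else 0)"
proof -
  have "(\<Sum>i\<le>k. (-1) ^ i) = (if even k then 1 else 0 :: real)"
    by (induction k) auto
  moreover have "(\<Sum>i\<le>k. 0 ^ i) = (1 :: real)"
    by (induction k) auto
  ultimately show ?thesis
    using assms by auto
qed

locale sign_character =
  fixes x :: "nat \<Rightarrow> real"
  assumes x_1: "x 1 = 1" and x_mult: "x (a * b) = x a * x b" and x_values: "x a \<in> {-1, 0, 1}"
begin

text \<open>The Dirichlet convolution of \<open>x\<close> with the constant 1; these numbers are the
  power series coefficients of the Lambert series of \<open>x\<close>.\<close>

definition r :: "nat \<Rightarrow> real" where
  "r N = (\<Sum>d | d dvd N. x d)"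

lemma x_power: "x (a ^ k) = x a ^ k"
  using x_1 by (induction k) (auto simp: x_mult)

lemma r_prime_power_mult:
  assumes "prime p" "\<not> p dvd N"
  shows "r (p ^ k * N) = (\<Sum>i\<le>k. x p ^ i) * r N"
proof -
  have "r (p ^ k * N) = (\<Sum>(i, d)\<in>{..k} \<times> {d. d dvd N}. x (p ^ i * d))"
    unfolding r_def divisors_prime_power_mult(1)[OF assms]
    by (subst sum.reindex[OF divisors_prime_power_mult(2)[OF assms]]) (simp add: case_prod_beta)
  also have "\<dots> = (\<Sum>(i, d)\<in>{..k} \<times> {d. d dvd N}. x p ^ i * x d)"
    by (simp add: x_mult x_power)
  also have "\<dots> = (\<Sum>i\<le>k. x p ^ i) * r N"
    by (simp add: r_def sum_product sum.cartesian_product)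
  finally show ?thesis .
qed

text \<open>The full power of one prime is split off at each step of the induction. Its factor is
  nonnegative, and at least 1 if the exponent is even, as all exponents of a square are.\<close>

lemma r_nonneg_square:
  assumes "N > 0"
  shows "r N \<ge> 0 \<and> (\<forall>M. N = M ^ 2 \<longrightarrow> r N \<ge> 1)"
  using assms
proof (induction N rule: less_induct)
  case (less N)
  show ?case
  proof (cases "N = 1")
    case True
    then have "r N = 1" using x_1 by (simp add: r_def)
    then show ?thesis by (simp only: order_refl zero_le_one simp_thms)
  next
    case False
    then obtain p where p: "prime p" "p dvd N"
      using prime_factor_nat by blast
    obtain k L where k_def: "k = multiplicity p N" and L: "N = p ^ k * L" "\<not> p dvd L"
      using multiplicity_decompose'[of N p] p less.prems by (metis not_prime_unit not_gr0)
    have "k > 0"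
      using p less.prems by (simp add: k_def prime_multiplicity_gt_zero_iff)
    have "L > 0"
      using L less.prems by (cases L) auto
    have "p ^ k > 1"
      using \<open>k > 0\<close> p(1) by (metis one_less_power prime_gt_1_nat)
    then have "L < N"
      using L(1) \<open>L > 0\<close> n_less_m_mult_n[of L "p ^ k"] by simp
    note IH = less.IH[OF this \<open>L > 0\<close>]
    have rN: "r N = (\<Sum>i\<le>k. x p ^ i) * r L"
      using r_prime_power_mult[OF p(1) L(2), of k] L(1) by simp
    note geo = geometric_sum_sign_ge[OF x_values[of p], of k]
    have "r N \<ge> 0"
      unfolding rN using IH geo by (intro mult_nonneg_nonneg) (auto split: if_splits)
    moreover have "r N \<ge> 1" if "N = M ^ 2" for M
    proof -
      have M0: "M \<noteq> 0" using that less.prems by (cases M) auto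
      obtain j Q where j: "j = multiplicity p M" and Q: "M = p ^ j * Q" "\<not> p dvd Q"
        using multiplicity_decompose'[of M p] p M0 by (metis not_prime_unit)
      have k: "k = 2 * j"
        using p(1) M0 by (simp add: k_def j that prime_elem_multiplicity_power_distrib)
      have "p ^ k * L = p ^ k * Q ^ 2"
      proof -
        have "p ^ k * L = M ^ 2"
          using L(1) that by simp
        also have "\<dots> = (p ^ j * Q) ^ 2"
          using Q(1) by simp
        also have "\<dots> = p ^ k * Q ^ 2"
          by (simp add: k power_mult_distrib mult.commute flip: power_mult)
        finally show ?thesis .
      qed
      then have "L = Q ^ 2"
        using p(1) by (simp add: prime_gt_0_nat)
      then have "r L \<ge> 1" using IH by blast
      moreover have "(\<Sum>i\<le>k. x p ^ i) \<ge> 1" using geo k by auto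
      ultimately show ?thesis
        unfolding rN using mult_mono[of 1 "\<Sum>i\<le>k. x p ^ i" 1 "r L"] by simp
    qed
    ultimately show ?thesis by blast
  qed
qed

lemma abs_x_le_1: "\<bar>x a\<bar> \<le> 1"
  using x_values[of a] by auto

text \<open>Expanding every \<open>t ^ m / (1 - t ^ m)\<close> as a geometric series and collecting
  the terms with \<open>m * j = N\<close> gives the power series with coefficients
  \<open>r N\<close>. Keeping only square indices, where \<open>r\<close> is at least 1, yields the
  lower bound.\<close>

lemma Lambert_series:
  assumes t: "0 < t" "t < 1"
  obtains S where "(\<lambda>m. x (Suc m) * (t ^ Suc m / (1 - t ^ Suc m))) sums S"
    and "\<And>K. (\<Sum>k=1..K. t ^ (k ^ 2)) \<le> S"
proof -
  let ?F = "\<lambda>(m, j). x m * t ^ (m * j)"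
  have pow_less: "t ^ m < 1" if "m \<ge> 1" for m
    using t that by (simp add: power_less_one_iff)
  have geo: "((\<lambda>j. t ^ (m * j)) has_sum (t ^ m / (1 - t ^ m))) {1..}" if "m \<ge> 1" for m
    using has_sum_geometric_from_1[of "t ^ m"] pow_less[OF that] t by (simp add: power_mult)
  \<comment> \<open>The comparison of \<open>1 / (1 - t ^ m)\<close> with \<open>1 / (1 - t)\<close>
    makes the double series absolutely convergent, which permits regrouping by the product.\<close>
  have "(\<lambda>m. t ^ m / (1 - t ^ m)) summable_on {1..}"
  proof (rule summable_on_comparison_test)
    show "(\<lambda>m. t ^ m * (1 / (1 - t))) summable_on {1..}"
      using has_sum_geometric_from_1[of t] t
      by (intro summable_on_cmult_left has_sum_imp_summable) auto
    show "t ^ m / (1 - t ^ m) \<le> t ^ m * (1 / (1 - t))" if "m \<in> {1..}" for m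
    proof -
      have "t ^ m \<le> t ^ 1"
        using t that by (intro power_decreasing) auto
      then show ?thesis
        using t pow_less[of m] that by (simp add: frac_le)
    qed
    show "0 \<le> t ^ m / (1 - t ^ m)" if "m \<in> {1..}" for m
      using t pow_less[of m] that by simp
  qed
  then have "(\<lambda>(m, j). t ^ (m * j)) summable_on {1..} \<times> {1..}"
    using geo t by (intro summable_on_SigmaI[where g = "\<lambda>m. t ^ m / (1 - t ^ m)"]) auto
  then have "(\<lambda>q. norm (?F q)) summable_on {1..} \<times> {1..}"
  proof (rule summable_on_comparison_test)
    fix q assume "q \<in> {1::nat..} \<times> {1::nat..}"
    show "norm (?F q) \<le> (\<lambda>(m, j). t ^ (m * j)) q"
      using t mult_right_mono[OF abs_x_le_1[of "fst q"], of "t ^ (fst q * snd q)"]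
      by (simp add: case_prod_beta abs_mult)
  qed auto
  then have "?F summable_on {1..} \<times> {1..}"
    by (rule abs_summable_summable)
  then obtain S where S: "(?F has_sum S) ({1..} \<times> {1..})"
    by (auto simp: summable_on_def)
  have "((\<lambda>m. x m * (t ^ m / (1 - t ^ m))) has_sum S) {1..}"
    by (rule has_sum_SigmaD[OF S]) (use geo in \<open>auto intro!: has_sum_cmult_right simp del: times_divide_eq_right\<close>)
  then have sums: "(\<lambda>m. x (Suc m) * (t ^ Suc m / (1 - t ^ Suc m))) sums S"
    by (rule has_sum_from_1_imp_sums)
  have "((\<lambda>(N, d). x d * t ^ N) has_sum S) (Sigma {1..} (\<lambda>N. {d. d dvd N}))"
  proof -
    have "((\<lambda>(N, d). x d * t ^ N) has_sum S) (Sigma {1..} (\<lambda>N. {d. d dvd N})) \<longleftrightarrow>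
        (?F has_sum S) ({1..} \<times> {1..})"
    proof (rule has_sum_reindex_bij_witness[where j = "\<lambda>(N, d). (d, N div d)"
          and i = "\<lambda>(m, j). (m * j, m)"])
      fix q assume "q \<in> (SIGMA N:{1..}. {d::nat. d dvd N})"
      then obtain d e where q: "q = (d * e, d)" "d * e \<ge> 1"
        by (auto simp: dvd_def)
      then have "d \<ge> 1" "e \<ge> 1"
        by (cases d; cases e; simp)+
      then show "(case case q of (N, d) \<Rightarrow> (d, N div d) of (m, j) \<Rightarrow> (m * j, m)) = q"
        "(case q of (N, d) \<Rightarrow> (d, N div d)) \<in> {1..} \<times> {1..}"
        "?F (case q of (N, d) \<Rightarrow> (d, N div d)) = (case q of (N, d) \<Rightarrow> x d * t ^ N)"
        by (auto simp: q)
    qed auto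
    then show ?thesis using S by simp
  qed
  then have rsum: "((\<lambda>N. r N * t ^ N) has_sum S) {1..}"
    by (rule has_sum_SigmaD)
       (use has_sum_finite in \<open>fastforce simp: r_def sum_distrib_right\<close>)
  have "(\<Sum>k=1..K. t ^ (k ^ 2)) \<le> S" for K
  proof -
    have "(\<Sum>k=1..K. t ^ (k ^ 2)) \<le> (\<Sum>k=1..K. r (k ^ 2) * t ^ (k ^ 2))"
    proof (rule sum_mono)
      fix k assume "k \<in> {1..K}"
      then have "r (k ^ 2) \<ge> 1"
        using r_nonneg_square[of "k ^ 2"] by auto
      then show "t ^ k\<^sup>2 \<le> r (k\<^sup>2) * t ^ k\<^sup>2"
        using t by simp
    qed
    also have "\<dots> = (\<Sum>N\<in>(\<lambda>k. k ^ 2) ` {1..K}. r N * t ^ N)"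
      by (subst sum.reindex) (auto simp: inj_on_def)
    also have "\<dots> \<le> S"
      by (rule finite_sum_le_has_sum[OF rsum]) (use r_nonneg_square t in auto)
    finally show ?thesis .
  qed
  then show ?thesis
    using that sums by blast
qed

end

subsection \<open>Non-vanishing for real characters\<close>

text \<open>The inequality of arithmetic and geometric means for u, u^3, ..., u^(2m-1), whose
  geometric mean is u^m. The induction goes in steps of two and removes the outermost pair, to which
  the case of two numbers applies.\<close>

lemma geometric_sum_ge:
  fixes u :: real
  assumes "0 \<le> u"
  shows "real m * u ^ m \<le> u * (\<Sum>i<m. u ^ (2 * i))"
proof (induction m rule: less_induct)
  case (less m)
  show ?case
  proof (cases "m < 2")
    case True
    then have "m = 0 \<or> m = 1" by auto
    then show ?thesis by auto
  next
    case False
    then obtain k where m: "m = Suc (Suc k)"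
      by (metis numeral_2_eq_2 not_less_eq old.nat.exhaust less_Suc_eq)
    have "(\<Sum>i<m. u ^ (2 * i)) = 1 + u ^ 2 * (\<Sum>i<k. u ^ (2 * i)) + u ^ (2 * k + 2)"
      unfolding m by (subst sum.lessThan_Suc_shift)
        (simp add: sum_distrib_left power_add power2_eq_square algebra_simps)
    then have eq: "u * (\<Sum>i<m. u ^ (2 * i)) =
        u * (1 + u ^ (2 * k + 2)) + u ^ 2 * (u * (\<Sum>i<k. u ^ (2 * i)))"
      by (simp add: algebra_simps)
    have "u ^ (2 * k + 2) = (u ^ Suc k) ^ 2"
      by (simp add: power_mult power2_eq_square algebra_simps)
    then have amgm: "2 * u ^ Suc k \<le> 1 + u ^ (2 * k + 2)"
      using sum_squares_bound[of 1 "u ^ Suc k"] by simp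
    have "real m * u ^ m = u * (2 * u ^ Suc k) + u ^ 2 * (real k * u ^ k)"
      unfolding m by (simp add: algebra_simps power2_eq_square)
    also have "\<dots> \<le> u * (\<Sum>i<m. u ^ (2 * i))"
      unfolding eq
      using less.IH[of k] m assms amgm by (intro add_mono mult_left_mono) auto
    finally show ?thesis .
  qed
qed

text \<open>The weights are those of Monsky's proof that \<open>L(1, \<chi>) \<noteq> 0\<close> for real \<open>\<chi>\<close>.\<close>

lemma Monsky_weights:
  fixes t :: real
  assumes t: "0 < t" "t < 1"
  defines "b \<equiv> \<lambda>m. 1 / (real (Suc m) * (1 - t)) - t ^ Suc m / (1 - t ^ Suc m)"
  shows "b 0 = 1" and "b m \<ge> 0" and "b (Suc m) \<le> b m"
proof -
  show "b 0 = 1"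
    using t by (simp add: b_def field_simps)
  define S where "S m = (\<Sum>i<m. t ^ i)" for m
  have S_eq: "1 - t ^ m = (1 - t) * S m" for m
    by (simp add: S_def one_diff_power_eq)
  have S_pos: "S (Suc m) > 0" for m
    unfolding S_def using t by (intro sum_pos) auto
  have b_eq: "b m = (1 / real (Suc m) - t ^ Suc m / S (Suc m)) / (1 - t)" for m
    unfolding b_def S_eq by (simp add: diff_divide_distrib mult.commute)
  have "real (Suc m) * t ^ Suc m = (\<Sum>i<Suc m. t ^ Suc m)"
    by simp
  also have "\<dots> \<le> S (Suc m)"
    unfolding S_def using t by (intro sum_mono power_decreasing) auto
  finally have "t ^ Suc m / S (Suc m) \<le> 1 / real (Suc m)"
    using S_pos[of m] by (simp add: field_simps)
  then show "b m \<ge> 0"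
    unfolding b_eq using t by simp
  \<comment> \<open>Taking \<open>u = sqrt t\<close> turns the even powers of \<open>u\<close> into
    powers of \<open>t\<close>. Two consecutive instances are multiplied below because the drop of
    \<open>t ^ m / S m\<close> has the denominator
    \<open>S (Suc m) * S (Suc (Suc m))\<close>.\<close>
  have ge: "real m * sqrt t ^ m \<le> sqrt t * S m" for m
  proof -
    have "sqrt t ^ (2 * i) = t ^ i" for i
      using t by (simp add: power_mult)
    then show ?thesis
      using geometric_sum_ge[of "sqrt t" m] t by (simp add: S_def)
  qed
  have "(real (Suc m) * sqrt t ^ Suc m) * (real (Suc (Suc m)) * sqrt t ^ Suc (Suc m))
      \<le> (sqrt t * S (Suc m)) * (sqrt t * S (Suc (Suc m)))"
    using t S_pos[of m] by (intro mult_mono ge) (auto simp: less_imp_le)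
  also have "\<dots> = t * (S (Suc m) * S (Suc (Suc m)))"
    using t by (simp add: algebra_simps)
  also have "(real (Suc m) * sqrt t ^ Suc m) * (real (Suc (Suc m)) * sqrt t ^ Suc (Suc m))
      = real (Suc m) * real (Suc (Suc m)) * (sqrt t * t ^ Suc m)"
  proof -
    have "v ^ Suc m * v ^ Suc (Suc m) = v * (v * v) ^ Suc m" for v :: real
      by (simp add: algebra_simps)
    from this[of "sqrt t"] have "sqrt t ^ Suc m * sqrt t ^ Suc (Suc m) = sqrt t * t ^ Suc m"
      using t by simp
    then show ?thesis
      by (metis mult.assoc mult.left_commute)
  qed
  finally have main: "real (Suc m) * real (Suc (Suc m)) * (sqrt t * t ^ Suc m)
      \<le> t * (S (Suc m) * S (Suc (Suc m)))" .
  have "t \<le> sqrt t"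
    using t by (simp add: real_le_rsqrt power2_eq_square mult_left_le)
  then have "real (Suc m) * real (Suc (Suc m)) * (t * t ^ Suc m)
      \<le> real (Suc m) * real (Suc (Suc m)) * (sqrt t * t ^ Suc m)"
    using t by (intro mult_left_mono mult_right_mono) auto
  also note main
  finally have "t * (real (Suc m) * real (Suc (Suc m)) * t ^ Suc m)
      \<le> t * (S (Suc m) * S (Suc (Suc m)))"
    by (simp add: algebra_simps)
  then have "real (Suc m) * real (Suc (Suc m)) * t ^ Suc m \<le> S (Suc m) * S (Suc (Suc m))"
    using t by (simp only: mult_le_cancel_left_pos)
  then have key: "t ^ Suc m / (S (Suc m) * S (Suc (Suc m)))
      \<le> 1 / (real (Suc m) * real (Suc (Suc m)))"
    using S_pos[of m] S_pos[of "Suc m"]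
    by (simp add: divide_simps mult_ac del: of_nat_Suc power_Suc)
  \<comment> \<open>By this recursion \<open>S (Suc (Suc m)) - t * S (Suc m)\<close> is 1, so the
    drop of \<open>t ^ m / S m\<close> is one fraction with numerator \<open>t ^ Suc m\<close>,
    comparable with the drop of 1/m.\<close>
  have "S (Suc (Suc m)) = 1 + t * S (Suc m)"
    unfolding S_def by (subst sum.lessThan_Suc_shift) (simp add: sum_distrib_left distrib_left)
  then have "t ^ Suc m / (S (Suc m) * S (Suc (Suc m)))
      = t ^ Suc m * (S (Suc (Suc m)) - t * S (Suc m)) / (S (Suc m) * S (Suc (Suc m)))"
    by simp
  also have "\<dots> = t ^ Suc m / S (Suc m) - t ^ Suc (Suc m) / S (Suc (Suc m))"
    using S_pos[of m] S_pos[of "Suc m"]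
    by (simp add: divide_simps algebra_simps del: power_Suc)
       (simp add: algebra_simps)
  finally have "t ^ Suc m / S (Suc m) - t ^ Suc (Suc m) / S (Suc (Suc m))
      \<le> 1 / (real (Suc m) * real (Suc (Suc m)))"
    using key by simp
  also have "\<dots> = 1 / real (Suc m) - 1 / real (Suc (Suc m))"
    by (simp add: field_simps)
  finally show "b (Suc m) \<le> b m"
    unfolding b_eq using t by (intro divide_right_mono) auto
qed

context dirichlet_character
begin

text \<open>If the value were 0, the Lambert series would be minus the series of \<open>chi\<close>
  with the weights of \<open>Monsky_weights\<close>, since these differ from the Lambert weights by
  a multiple of the vanishing series. The weights decrease from 1, so summation by parts bounds the
  Lambert series by \<open>n\<close> uniformly in \<open>t\<close>, while its lower bound by powers
  with square exponents exceeds \<open>n\<close> for \<open>t\<close> near 1.\<close>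

lemma L1_nonzero_real:
  assumes b: "coprime b (int n)" "chi b \<noteq> 1"
    and real: "\<And>a. coprime a (int n) \<Longrightarrow> chi a ^ 2 = 1"
  shows "(\<Sum>m. chi (int (Suc m)) / of_nat (Suc m)) \<noteq> 0"
proof
  assume "(\<Sum>m. chi (int (Suc m)) / of_nat (Suc m)) = 0"
  then have L0: "(\<lambda>m. chi (int (Suc m)) / of_nat (Suc m)) sums 0"
    using summable_L1[OF b] by (metis summable_sums)
  define x where "x a = Re (chi (int a))" for a
  have vals: "chi a \<in> {-1, 0, 1}" for a
    using real[of a] eq_0_iff[of a] by (auto simp: power2_eq_1_iff)
  have chi_x: "chi (int a) = of_real (x a)" for a
    using vals[of "int a"] by (auto simp: x_def)
  interpret sign_character x
  proof
    show "x 1 = 1" by (simp add: x_def)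
    show "x (a * c) = x a * x c" for a c
      using vals[of "int a"] vals[of "int c"] by (auto simp: x_def mult)
    show "x a \<in> {-1, 0, 1}" for a
      using vals[of "int a"] by (auto simp: x_def)
  qed
  have bound: "(\<Sum>k=1..K. t ^ (k ^ 2)) \<le> real n" if t: "0 < t" "t < 1" for K and t :: real
  proof -
    define w where "w m = 1 / (real (Suc m) * (1 - t)) - t ^ Suc m / (1 - t ^ Suc m)" for m
    obtain S where S: "(\<lambda>m. x (Suc m) * (t ^ Suc m / (1 - t ^ Suc m))) sums S"
      and le: "\<And>K. (\<Sum>k=1..K. t ^ (k ^ 2)) \<le> S"
      using Lambert_series[OF t] by blast
    have "(\<lambda>m. chi (int (Suc m)) / of_nat (Suc m) * (1 / (1 - of_real t))
        - of_real (x (Suc m) * (t ^ Suc m / (1 - t ^ Suc m)))) sums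
        (0 * (1 / (1 - of_real t)) - of_real S)"
      by (intro sums_diff sums_mult2 L0 sums_of_real S)
    then have "(\<lambda>m. chi (int (Suc m)) * of_real (w m)) sums (- of_real S)"
      unfolding chi_x w_def by (simp add: algebra_simps)
    then have "(\<lambda>N. \<Sum>m<N. chi (int (Suc m)) * of_real (w m)) \<longlonglongrightarrow> - of_real S"
      by (simp add: sums_def)
    then have "norm (- of_real S :: complex) \<le> real n * w 0"
      by (rule tendsto_upperbound[OF tendsto_norm])
         (use norm_sum_mult_antimono_le[OF norm_partial_sum_le[OF b], of w] Monsky_weights[OF t]
          in \<open>auto simp: w_def[abs_def]\<close>)
    then show ?thesis
      using le[of K] Monsky_weights(1)[OF t] by (simp add: w_def)
  qed
  \<comment> \<open>\<open>Suc n\<close> squares are enough: the sum tends to n + 1, one more than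
    the uniform bound allows.\<close>
  have "((\<lambda>t::real. \<Sum>k=1..Suc n. t ^ (k ^ 2)) \<longlongrightarrow> (\<Sum>k=1..Suc n. 1 ^ (k ^ 2))) (at_left 1)"
    by (intro tendsto_intros)
  moreover have "\<forall>\<^sub>F t::real in at_left 1. (\<Sum>k=1..Suc n. t ^ (k ^ 2)) \<le> real n"
    using eventually_at_left_real[OF zero_less_one] by eventually_elim (rule bound, auto)
  ultimately have "(\<Sum>k=1..Suc n. (1::real) ^ (k ^ 2)) \<le> real n"
    by (rule tendsto_upperbound) simp
  then show False by simp
qed

end

subsection \<open>Non-vanishing for non-real characters\<close>

text \<open>In the logarithm of the left side the coefficient of z^k/k is minus 3 + 4c + (2c^2 - 1)
  = 2(1 + c)^2, where c is the real part of w^k. The case \<open>w = 0\<close> serves the primes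
  dividing the modulus.\<close>

lemma norm_341_le_1:
  fixes w :: complex and z :: real
  assumes w: "w = 0 \<or> norm w = 1" and z: "0 \<le> z" "z < 1"
  shows "norm (1 - of_real z :: complex) ^ 3 * norm (1 - w * of_real z) ^ 4
    * norm (1 - w ^ 2 * of_real z) \<le> 1"
proof (cases "w = 0")
  case True
  have "norm (1 - of_real z :: complex) = \<bar>1 - z\<bar>"
    by (metis norm_of_real of_real_1 of_real_diff)
  then show ?thesis
    using True z by (simp add: power_le_one)
next
  case False
  then have w1: "norm w = 1" using w by simp
  have lt: "norm (w ^ j * of_real z) < 1" for j
    using z w1 by (simp add: norm_mult norm_power)
  have nz: "1 - w ^ j * of_real z \<noteq> 0" for j
    using lt[of j] by (metis eq_iff_diff_eq_0 norm_one less_irrefl)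
  \<comment> \<open>The index starts at 0, where division by \<open>real 0\<close> makes the term
    0.\<close>
  have ln_sums: "(\<lambda>k. - (Re (w ^ (j * k)) * z ^ k / real k)) sums ln (norm (1 - w ^ j * of_real z))" for j
  proof -
    have "(\<lambda>k. - ((- (- (w ^ j * of_real z))) ^ k) / of_nat k) sums ln (1 + - (w ^ j * of_real z))"
      by (rule Ln_series') (use lt in simp)
    then have "(\<lambda>k. Re (- ((w ^ j * of_real z) ^ k) / of_nat k)) sums Re (ln (1 - w ^ j * of_real z))"
      by (intro sums_Re) simp
    moreover have "Re (- ((w ^ j * of_real z) ^ k) / of_nat k) = - (Re (w ^ (j * k)) * z ^ k / real k)" for k
    proof -
      have "- ((w ^ j * of_real z) ^ k) / of_nat k = w ^ (j * k) * of_real (- (z ^ k / real k))"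
        by (simp add: power_mult_distrib power_mult)
      also have "Re \<dots> = Re (w ^ (j * k)) * - (z ^ k / real k)"
        by (simp only: times_complex.simps Re_complex_of_real Im_complex_of_real)
      finally show ?thesis by simp
    qed
    moreover have "Re (ln (1 - w ^ j * of_real z)) = ln (norm (1 - w ^ j * of_real z))"
      using nz[of j] by simp
    ultimately show ?thesis
      by (simp only:)
  qed
  have sums341: "(\<lambda>k. 3 * - (Re (w ^ (0 * k)) * z ^ k / real k) + 4 * - (Re (w ^ (1 * k)) * z ^ k / real k)
        + - (Re (w ^ (2 * k)) * z ^ k / real k)) sums
      (3 * ln (norm (1 - w ^ 0 * of_real z)) + 4 * ln (norm (1 - w ^ 1 * of_real z))
        + ln (norm (1 - w ^ 2 * of_real z)))"
    by (intro sums_add sums_mult ln_sums)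
  have le341: "3 * - (Re (w ^ (0 * k)) * z ^ k / real k) + 4 * - (Re (w ^ (1 * k)) * z ^ k / real k)
        + - (Re (w ^ (2 * k)) * z ^ k / real k) \<le> 0" for k
  proof -
    define c where "c = Re (w ^ k)"
    have "norm (w ^ k) = 1" using w1 by (simp add: norm_power)
    then have "c ^ 2 + Im (w ^ k) ^ 2 = 1"
      by (metis c_def cmod_power2 one_power2)
    then have c2: "Re (w ^ (2 * k)) = 2 * c ^ 2 - 1"
      by (simp add: c_def mult.commute[of 2] power_mult power2_eq_square)
    have "3 * - (Re (w ^ (0 * k)) * z ^ k / real k) + 4 * - (Re (w ^ (1 * k)) * z ^ k / real k)
        + - (Re (w ^ (2 * k)) * z ^ k / real k) = - (2 * (1 + c) ^ 2) * (z ^ k / real k)"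
      unfolding c2 by (simp add: c_def[symmetric] algebra_simps power2_eq_square
          add_divide_distrib diff_divide_distrib)
    also have "\<dots> \<le> 0"
      using z by (intro mult_nonpos_nonneg) auto
    finally show ?thesis .
  qed
  have "3 * ln (norm (1 - w ^ 0 * of_real z)) + 4 * ln (norm (1 - w ^ 1 * of_real z))
        + ln (norm (1 - w ^ 2 * of_real z)) \<le> 0"
    by (rule sums_le[OF le341 sums341 sums_zero])
  moreover have "ln (norm (1 - w ^ 0 * of_real z) ^ 3 * norm (1 - w ^ 1 * of_real z) ^ 4
    * norm (1 - w ^ 2 * of_real z)) = 3 * ln (norm (1 - w ^ 0 * of_real z))
      + 4 * ln (norm (1 - w ^ 1 * of_real z)) + ln (norm (1 - w ^ 2 * of_real z))"
    using nz[of 0] nz[of 1] nz[of 2] by (simp add: ln_mult ln_realpow)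
  ultimately have "norm (1 - w ^ 0 * of_real z) ^ 3 * norm (1 - w ^ 1 * of_real z) ^ 4
    * norm (1 - w ^ 2 * of_real z) \<le> 1"
    using nz[of 0] nz[of 1] nz[of 2]
    by (subst ln_le_zero_iff[symmetric]) (auto intro!: mult_pos_pos zero_less_power)
  then show ?thesis by simp
qed

section \<open>Euler products of completely multiplicative functions, obtained by sieving\<close>

lemma infsum_sieve:
  fixes f :: "nat \<Rightarrow> complex"
  assumes mult: "\<And>a b. f (a * b) = f a * f b"
    and summable: "(\<lambda>m. norm (f m)) summable_on {1..}"
    and P: "finite P" "\<And>p. p \<in> P \<Longrightarrow> prime p"
  shows "infsum f {m. m \<ge> 1 \<and> (\<forall>p\<in>P. \<not> p dvd m)} = (\<Prod>p\<in>P. 1 - f p) * infsum f {1..}"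
  using P
proof (induction P rule: finite_induct)
  case empty
  then show ?case by (simp add: atLeast_def)
next
  case (insert q P)
  define A where "A = {m. m \<ge> 1 \<and> (\<forall>p\<in>P. \<not> p dvd m)}"
  define B where "B = {m. m \<ge> 1 \<and> (\<forall>p\<in>insert q P. \<not> p dvd m)}"
  have q: "prime q" using insert.prems by simp
  have f_sum: "f summable_on X" if "X \<subseteq> {1..}" for X
    using abs_summable_summable[OF summable] that by (rule summable_on_subset_banach)
  \<comment> \<open>Multiplication by the new prime \<open>q\<close> does not affect divisibility by
    the primes in \<open>P\<close>, so the multiples of \<open>q\<close> in \<open>A\<close> are
    exactly \<open>q\<close> times \<open>A\<close>, and their sum is \<open>f q\<close> times the
    sum over \<open>A\<close>.\<close>
  have AB: "A = B \<union> (\<lambda>m. q * m) ` A"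
  proof (intro equalityI subsetI)
    fix m assume "m \<in> A"
    then show "m \<in> B \<union> (\<lambda>m. q * m) ` A"
      by (cases "q dvd m") (fastforce simp: A_def B_def dvd_def image_iff)+
  next
    fix m assume "m \<in> B \<union> (\<lambda>m. q * m) ` A"
    then consider "m \<in> B" | k where "m = q * k" "k \<in> A" by auto
    then show "m \<in> A"
    proof cases
      case 2
      have "\<not> p dvd q * k" if "p \<in> P" for p
      proof -
        have p: "prime p" "p \<noteq> q"
          using that insert.prems insert.hyps by auto
        then have "\<not> p dvd q"
          using q primes_dvd_imp_eq by blast
        then show ?thesis
          using that 2 p by (auto simp: A_def prime_dvd_mult_iff)
      qed
      then show ?thesis
        using 2 prime_gt_0_nat[OF q] by (auto simp: A_def)
    qed (auto simp: A_def B_def)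
  qed
  have "infsum f A = infsum f B + infsum f ((\<lambda>m. q * m) ` A)"
    by (subst AB, rule infsum_Un_disjoint)
       (use AB in \<open>auto intro!: f_sum simp: A_def B_def\<close>)
  also have "infsum f ((\<lambda>m. q * m) ` A) = f q * infsum f A"
    using prime_gt_0_nat[OF q]
    by (subst infsum_reindex) (auto simp: inj_on_def o_def mult infsum_cmult_right')
  finally have "infsum f B = (1 - f q) * infsum f A"
    by (metis add_diff_cancel_right' left_diff_distrib mult_1)
  then show ?case
    using insert by (simp add: A_def B_def)
qed

text \<open>After sieving by the primes up to \<open>N\<close> only 1 and numbers above
  \<open>N\<close> survive, so the error is at most a tail of the absolutely convergent series. With
  the product on the side of the sum, no factor has to be inverted.\<close>

lemma Euler_product:
  fixes f :: "nat \<Rightarrow> complex"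
  assumes one: "f 1 = 1" and mult: "\<And>a b. f (a * b) = f a * f b"
    and summable: "(\<lambda>m. norm (f m)) summable_on {1..}"
  shows "(\<lambda>N. (\<Prod>p | prime p \<and> p \<le> N. 1 - f p) * infsum f {1..}) \<longlonglongrightarrow> 1"
proof -
  have sub: "(\<lambda>m. norm (f m)) summable_on X" if "X \<subseteq> {1..}" for X
    using summable that by (rule summable_on_subset_banach)
  have norm_sums: "(\<lambda>m. norm (f (Suc m))) sums infsum (\<lambda>m. norm (f m)) {1..}"
    using has_sum_from_1_imp_sums[OF has_sum_infsum[OF summable]] .
  have "norm ((\<Prod>p | prime p \<and> p \<le> N. 1 - f p) * infsum f {1..} - 1)
      \<le> infsum (\<lambda>m. norm (f m)) {1..} - (\<Sum>m<N. norm (f (Suc m)))" if "N \<ge> 1" for N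
  proof -
    define A where "A = {m. m \<ge> 1 \<and> (\<forall>p\<in>{p. prime p \<and> p \<le> N}. \<not> p dvd m)}"
    have "m > N" if m: "m \<in> A" "m \<noteq> 1" for m
    proof (rule ccontr)
      assume "\<not> m > N"
      obtain p where "prime p" "p dvd m"
        using \<open>m \<noteq> 1\<close> prime_factor_nat by blast
      then show False
        using m \<open>\<not> m > N\<close> dvd_imp_le[of p m] by (auto simp: A_def)
    qed
    then have A: "A - {1} \<subseteq> {N<..}" by auto
    have "1 \<in> A" by (auto simp: A_def)
    then have "infsum f A = infsum f (insert 1 (A - {1}))"
      by (simp add: insert_absorb)
    also have "\<dots> = f 1 + infsum f (A - {1})"
      by (rule infsum_insert) (auto intro!: abs_summable_summable sub simp: A_def)
    finally have "infsum f A - 1 = infsum f (A - {1})"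
      using one by simp
    then have "norm (infsum f A - 1) \<le> infsum (\<lambda>m. norm (f m)) (A - {1})"
      using norm_infsum_bound[of f "A - {1}"] sub[of "A - {1}"] by (auto simp: A_def)
    also have "\<dots> \<le> infsum (\<lambda>m. norm (f m)) {N<..}"
      by (rule infsum_mono_neutral) (use A in \<open>auto intro!: sub simp: A_def\<close>)
    also have "\<dots> = infsum (\<lambda>m. norm (f m)) {1..} - (\<Sum>m<N. norm (f (Suc m)))"
    proof -
      have "{1..N} \<union> {N<..} = {1..}" using that by auto
      then have "infsum (\<lambda>m. norm (f m)) {1..} = infsum (\<lambda>m. norm (f m)) ({1..N} \<union> {N<..})"
        by (simp only:)
      also have "\<dots> = (\<Sum>m=1..N. norm (f m)) + infsum (\<lambda>m. norm (f m)) {N<..}"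
        by (subst infsum_Un_disjoint) (auto intro!: sub)
      also have "(\<Sum>m=1..N. norm (f m)) = (\<Sum>m<N. norm (f (Suc m)))"
        by (rule sum.reindex_bij_witness[of _ Suc "\<lambda>m. m - 1"]) auto
      finally show ?thesis by simp
    qed
    also have "infsum f A = (\<Prod>p | prime p \<and> p \<le> N. 1 - f p) * infsum f {1..}"
      unfolding A_def by (rule infsum_sieve[OF mult summable]) auto
    finally show ?thesis .
  qed
  then have "\<forall>\<^sub>F N in sequentially. norm ((\<Prod>p | prime p \<and> p \<le> N. 1 - f p) * infsum f {1..} - 1)
      \<le> infsum (\<lambda>m. norm (f m)) {1..} - (\<Sum>m<N. norm (f (Suc m)))"
    by (rule eventually_sequentiallyI)
  moreover have "(\<lambda>N. infsum (\<lambda>m. norm (f m)) {1..} - (\<Sum>m<N. norm (f (Suc m)))) \<longlonglongrightarrow> 0"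
    using tendsto_diff[OF tendsto_const norm_sums[unfolded sums_def],
        of "infsum (\<lambda>m. norm (f m)) {1..}"] by (simp only: diff_self)
  ultimately have "(\<lambda>N. (\<Prod>p | prime p \<and> p \<le> N. 1 - f p) * infsum f {1..} - 1) \<longlonglongrightarrow> 0"
    by (rule Lim_null_comparison)
  then show ?thesis
    by (simp add: LIM_zero_iff)
qed

section \<open>Real estimates for powers with exponent near -1\<close>

lemma one_minus_powr_le:
  fixes t u :: real
  assumes "t \<ge> 1"
  shows "1 - t powr (- u) \<le> u * ln t"
  using assms exp_ge_add_one_self[of "- u * ln t"] by (simp add: powr_def)

lemma ln_le_two_powr_half:
  fixes t :: real
  assumes "t \<ge> 1"
  shows "ln t \<le> 2 * t powr (1/2)"
proof -
  have "ln t = 2 * ln (t powr (1/2))"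
    using assms by simp
  also have "\<dots> \<le> 2 * t powr (1/2)"
    using assms ln_le_minus_one[of "t powr (1/2)"] by simp
  finally show ?thesis .
qed

text \<open>By the mean value theorem it suffices to bound the derivative, which is (s-1) y^(-s-1) -
  y^(-2) (1 - y^(-(s-1))). The first part contributes 1 to the constant 3; the second contributes 2
  through 1 - y^(-(s-1)) <= (s-1) ln y and ln y <= 2 y^(1/2). The exponent -3/2 keeps the bound
  summable over the integers, uniformly in \<open>s\<close>.\<close>

lemma powr_diff_variation:
  fixes s t :: real
  assumes s: "s > 1" and t: "t \<ge> 1"
  shows "\<bar>((t + 1) powr -1 - (t + 1) powr -s) - (t powr -1 - t powr -s)\<bar> \<le> 3 * (s - 1) * t powr (-3/2)"
proof -
  let ?g = "\<lambda>t. t powr -1 - t powr -s"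
  let ?g' = "\<lambda>t. - (t powr -2) + s * t powr (-s - 1)"
  have "(?g has_real_derivative ?g' y) (at y)" if "t \<le> y" for y
    using DERIV_diff[OF has_real_derivative_powr[of y "-1"] has_real_derivative_powr[of y "-s"]] t that
    by simp
  then obtain y where y: "t < y" "y < t + 1" "?g (t + 1) - ?g t = (t + 1 - t) * ?g' y"
    using MVT2[of t "t + 1" ?g ?g'] by auto
  have y1: "y \<ge> 1" using y t by simp
  have "\<bar>?g' y\<bar> \<le> 3 * (s - 1) * y powr (-3/2)"
  proof -
    have eq: "?g' y = (s - 1) * y powr (-s - 1) - y powr -2 * (1 - y powr - (s - 1))"
    proof -
      have "y powr (-s - 1) = y powr -2 * y powr - (s - 1)"
        by (subst powr_add[symmetric]) (rule arg_cong, simp)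
      then show ?thesis
        by (simp add: algebra_simps)
    qed
    have "0 \<le> 1 - y powr - (s - 1)"
      using y1 s powr_mono[of "-(s-1)" 0 y] by simp
    moreover have "y powr -2 * (1 - y powr - (s - 1)) \<le> 2 * (s - 1) * y powr (-3/2)"
    proof -
      have "1 - y powr - (s - 1) \<le> (s - 1) * ln y"
        by (rule one_minus_powr_le[OF y1])
      also have "\<dots> \<le> (s - 1) * (2 * y powr (1/2))"
        using s ln_le_two_powr_half[OF y1] by simp
      finally have "y powr -2 * (1 - y powr - (s - 1)) \<le> y powr -2 * ((s - 1) * (2 * y powr (1/2)))"
        by (rule mult_left_mono) simp
      also have "\<dots> = 2 * (s - 1) * (y powr -2 * y powr (1/2))"
        by simp
      also have "y powr -2 * y powr (1/2) = y powr (-3/2)"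
        by (simp flip: powr_add)
      finally show ?thesis .
    qed
    moreover have "(s - 1) * y powr (-s - 1) \<le> (s - 1) * y powr (-3/2)"
      using s y1 by (intro mult_left_mono powr_mono) auto
    moreover have "(s - 1) * y powr (-s - 1) \<ge> 0"
      using s by simp
    ultimately show ?thesis
      unfolding eq abs_le_iff
      by (smt (verit) mult_nonneg_nonneg powr_ge_zero mult.assoc distrib_right)
  qed
  also have "\<dots> \<le> 3 * (s - 1) * t powr (-3/2)"
    using s t y by (intro mult_left_mono powr_mono2') auto
  finally show ?thesis
    using y(3) by simp
qed

text \<open>Comparison with the integral of x^(-s) from 1 to infinity, which is 1/(s-1), plus the
  first term 1. The induction carries out the comparison by the mean value theorem. This is the
  upper bound for the pole of zeta.\<close>

lemma sum_powr_le:
  fixes s :: real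
  assumes s: "s > 1"
  shows "(\<Sum>m<N. real (Suc m) powr -s) \<le> s / (s - 1)"
proof -
  have "(s - 1) * (\<Sum>m<Suc N. real (Suc m) powr -s) \<le> s - real (Suc N) powr (1 - s)" for N
  proof (induction N)
    case 0
    then show ?case by simp
  next
    case (Suc N)
    let ?g = "\<lambda>t::real. t powr (1 - s)"
    let ?g' = "\<lambda>t::real. (1 - s) * t powr (- s)"
    have "(?g has_real_derivative ?g' y) (at y)" if "real (Suc N) \<le> y" for y
      using has_real_derivative_powr[of y "1 - s"] that by simp
    then obtain y where y: "real (Suc N) < y" "y < real (Suc (Suc N))"
      "?g (real (Suc (Suc N))) - ?g (real (Suc N)) = (real (Suc (Suc N)) - real (Suc N)) * ?g' y"
      using MVT2[of "real (Suc N)" "real (Suc (Suc N))" ?g ?g'] by auto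
    have "real (Suc (Suc N)) powr -s \<le> y powr -s"
      using y s by (intro powr_mono2') auto
    then have "(s - 1) * real (Suc (Suc N)) powr -s \<le> (s - 1) * y powr -s"
      using s by (intro mult_left_mono) auto
    moreover have "?g (real (Suc (Suc N))) - ?g (real (Suc N)) = - ((s - 1) * y powr -s)"
      using y(3) by (simp add: algebra_simps)
    moreover have "(s - 1) * (\<Sum>m<Suc (Suc N). real (Suc m) powr -s) =
        (s - 1) * (\<Sum>m<Suc N. real (Suc m) powr -s) + (s - 1) * real (Suc (Suc N)) powr -s"
      by (simp add: distrib_left)
    ultimately show ?case
      using Suc.IH by linarith
  qed
  from this[of N] have "(s - 1) * (\<Sum>m<Suc N. real (Suc m) powr -s) \<le> s"
    using powr_ge_zero[of "real (Suc N)" "1 - s"] by linarith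
  moreover have "(\<Sum>m<N. real (Suc m) powr -s) \<le> (\<Sum>m<Suc N. real (Suc m) powr -s)"
    by simp
  ultimately show ?thesis
    using s by (smt (verit) mult_left_mono pos_le_divide_eq mult.commute)
qed

lemma powr_abs_summable_on:
  fixes s :: real
  assumes "s > 1"
  shows "(\<lambda>m. real m powr -s) summable_on {1..}"
proof -
  have "summable (\<lambda>m. norm (real m powr -s))"
    using assms summable_real_powr_iff[of "-s"] by simp
  then have "(\<lambda>m. real m powr -s) summable_on UNIV"
    by (rule norm_summable_imp_summable_on)
  then show ?thesis
    by (rule summable_on_subset_banach) simp
qed

section \<open>L-series for real s > 1 and their behaviour as s tends to 1\<close>

context dirichlet_character
begin

text \<open>The unordered sum requires absolute convergence and is used for \<open>s > 1\<close>.
  The value at 1 converges only conditionally for non-principal characters and always appears as an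
  ordered series.\<close>

definition L :: "real \<Rightarrow> complex" where
  "L s = infsum (\<lambda>m. chi (int m) * of_real (real m powr -s)) {1..}"

lemma norm_summable_L:
  assumes "s > 1"
  shows "(\<lambda>m. norm (chi (int m) * of_real (real m powr -s))) summable_on {1..}"
  by (rule summable_on_comparison_test[OF powr_abs_summable_on[OF assms]])
     (auto simp: norm_mult intro!: mult_left_le_one_le norm_le_1)

lemma L_sums:
  assumes "s > 1"
  shows "(\<lambda>m. chi (int (Suc m)) * of_real (real (Suc m) powr -s)) sums L s"
  unfolding L_def
  by (rule has_sum_from_1_imp_sums[OF has_sum_infsum[OF abs_summable_summable[OF norm_summable_L[OF assms]]]])

lemma L_Euler_product:
  assumes "s > 1"
  shows "(\<lambda>N. (\<Prod>p | prime p \<and> p \<le> N. 1 - chi (int p) * of_real (real p powr -s)) * L s) \<longlonglongrightarrow> 1"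
  unfolding L_def
  by (rule Euler_product[OF _ _ norm_summable_L[OF assms]]) (auto simp: mult powr_mult)

lemma norm_L_le:
  assumes "coprime b (int n)" "chi b \<noteq> 1" "s > 1"
  shows "norm (L s) \<le> real n"
proof -
  have "(\<lambda>N. norm (\<Sum>m<N. chi (int (Suc m)) * of_real (real (Suc m) powr -s))) \<longlonglongrightarrow> norm (L s)"
    using L_sums[OF assms(3)] unfolding sums_def by (rule tendsto_norm)
  moreover have "norm (\<Sum>m<N. chi (int (Suc m)) * of_real (real (Suc m) powr -s))
      \<le> real n * real (Suc 0) powr -s" for N
    by (rule norm_sum_mult_antimono_le[OF norm_partial_sum_le[OF assms(1,2)]])
       (use assms in \<open>auto intro!: powr_mono2'\<close>)
  ultimately show ?thesis
    by (intro tendsto_upperbound[where F = sequentially]) auto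
qed

text \<open>This replaces differentiability at 1. Subtracting the vanishing series at 1 leaves the
  weights 1/m - 1/m^s, which start at 0, are positive afterwards and tend to 0; so they are not
  monotone and their variation is needed. The boundary term contributes the 1 and the variation the
  3 in the constant.\<close>

lemma norm_L_le_linear:
  assumes b: "coprime b (int n)" "chi b \<noteq> 1" and s: "s > 1"
    and L1: "(\<Sum>m. chi (int (Suc m)) / of_nat (Suc m)) = 0"
  shows "norm (L s) \<le> real n * (1 + 3 * (\<Sum>m. real (Suc m) powr (-3/2))) * (s - 1)"
proof -
  define w where "w m = real (Suc m) powr -1 - real (Suc m) powr -s" for m
  define Z where "Z = (\<Sum>m. real (Suc m) powr (-3/2))"
  have Zsum: "summable (\<lambda>m. real (Suc m) powr (-3/2))"
    using summable_real_powr_iff[of "-3/2"] by (subst summable_Suc_iff) simp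
  have "(\<lambda>m. chi (int (Suc m)) / of_nat (Suc m)) sums 0"
    using summable_L1[OF b] L1 by (metis summable_sums)
  from sums_diff[OF this L_sums[OF s]]
  have "(\<lambda>m. chi (int (Suc m)) * of_real (w m)) sums (- L s)"
    by (simp add: w_def algebra_simps powr_minus divide_inverse)
  then have "(\<lambda>N. norm (\<Sum>m<N. chi (int (Suc m)) * of_real (w m))) \<longlonglongrightarrow> norm (- L s)"
    unfolding sums_def by (rule tendsto_norm)
  moreover have "norm (\<Sum>m<N. chi (int (Suc m)) * of_real (w m)) \<le> real n * (1 + 3 * Z) * (s - 1)" for N
  proof -
    have w_le: "\<bar>w N\<bar> \<le> s - 1"
    proof -
      let ?M = "real (Suc N)"
      have eq: "w N = ?M powr -1 * (1 - ?M powr - (s - 1))"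
      proof -
        have "?M powr -s = ?M powr -1 * ?M powr - (s - 1)"
          by (subst powr_add[symmetric]) simp
        then show ?thesis
          by (simp only: w_def right_diff_distrib mult_1_right)
      qed
      have "0 \<le> 1 - ?M powr - (s - 1)"
        using s powr_mono[of "-(s-1)" 0 ?M] by simp
      then have "\<bar>w N\<bar> = ?M powr -1 * (1 - ?M powr - (s - 1))"
        unfolding eq by (simp add: abs_mult)
      also have "\<dots> \<le> ?M powr -1 * ((s - 1) * ?M)"
      proof (rule mult_left_mono)
        have "1 - ?M powr - (s - 1) \<le> (s - 1) * ln ?M"
          by (rule one_minus_powr_le) simp
        also have "\<dots> \<le> (s - 1) * ?M"
          using s ln_le_minus_one[of ?M] by (intro mult_left_mono) auto
        finally show "1 - ?M powr - (s - 1) \<le> (s - 1) * ?M" .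
      qed simp
      also have "\<dots> = s - 1"
        by (simp add: powr_minus)
      finally show ?thesis .
    qed
    have "(\<Sum>m<N. \<bar>w m - w (Suc m)\<bar>) \<le> (\<Sum>m<N. 3 * (s - 1) * real (Suc m) powr (-3/2))"
    proof (rule sum_mono)
      fix m
      show "\<bar>w m - w (Suc m)\<bar> \<le> 3 * (s - 1) * real (Suc m) powr (-3/2)"
        using powr_diff_variation[OF s, of "real (Suc m)"]
        by (simp add: w_def abs_minus_commute add.commute)
    qed
    also have "\<dots> = 3 * (s - 1) * (\<Sum>m<N. real (Suc m) powr (-3/2))"
      by (simp add: sum_distrib_left)
    also have "\<dots> \<le> 3 * (s - 1) * Z"
      unfolding Z_def using s Zsum by (intro mult_left_mono sum_le_suminf) auto
    finally have "\<bar>w N\<bar> + (\<Sum>m<N. \<bar>w m - w (Suc m)\<bar>) \<le> (1 + 3 * Z) * (s - 1)"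
      using w_le by (simp add: algebra_simps)
    then have "real n * (\<bar>w N\<bar> + (\<Sum>m<N. \<bar>w m - w (Suc m)\<bar>)) \<le> real n * ((1 + 3 * Z) * (s - 1))"
      by (rule mult_left_mono) simp
    then show ?thesis
      using norm_sum_mult_le_variation[OF norm_partial_sum_le[OF b], where N = N and b = w]
      by (simp only: mult.assoc)
  qed
  ultimately have "norm (- L s) \<le> real n * (1 + 3 * Z) * (s - 1)"
    by (intro tendsto_upperbound[where F = sequentially]) auto
  then show ?thesis
    by (simp add: Z_def)
qed

text \<open>
  A zero of \<open>L(s, \<chi>)\<close> at \<open>s = 1\<close> would make \<open>\<zeta>(s)\<^sup>3 L(s, \<chi>)\<^sup>4 L(s, \<chi>\<^sup>2)\<close> tend to 0 for
  \<open>s \<rightarrow> 1\<close>, because \<open>\<chi>\<^sup>2\<close> is still non-principal and the pole of \<open>\<zeta>\<close> is simple; but the Euler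
  product bounds the absolute value of this expression below by 1.
\<close>

lemma L1_nonzero_nonreal:
  assumes b: "coprime b (int n)" "chi b ^ 2 \<noteq> 1"
  shows "(\<Sum>m. chi (int (Suc m)) / of_nat (Suc m)) \<noteq> 0"
proof
  assume L1: "(\<Sum>m. chi (int (Suc m)) / of_nat (Suc m)) = 0"
  interpret sq: dirichlet_character n "\<lambda>a. chi a ^ 2"
    by (rule square)
  have b': "chi b \<noteq> 1"
    using b by auto
  define C where "C = real n * (1 + 3 * (\<Sum>m. real (Suc m) powr (-3/2)))"
  \<comment> \<open>Bounding zeta by s/(s-1), L(s, chi) by C (s-1) and L(s, chi^2) by n leaves s^3
    C^4 n (s-1). For s <= 2 this is at most D (s-1), the 8 coming from s^3, and the choice s - 1 =
    1/(1+D) makes it less than 1.\<close>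
  define D where "D = 8 * C ^ 4 * real n"
  define e where "e = 1 / (1 + D)"
  define s where "s = 1 + e"
  have C0: "D \<ge> 0"
    by (simp add: D_def)
  then have e: "e > 0" "e \<le> 1"
    by (auto simp: e_def field_simps)
  then have s: "s > 1"
    by (simp add: s_def)
  define zeta :: complex where "zeta = infsum (\<lambda>m. of_real (real m powr -s)) {1..}"
  have zs: "(\<lambda>m. norm (complex_of_real (real m powr -s))) summable_on {1..}"
    using powr_abs_summable_on[OF s] by simp
  define P0 where "P0 N = (\<Prod>p | prime p \<and> p \<le> N. 1 - complex_of_real (real p powr -s))" for N
  define P1 where "P1 N = (\<Prod>p | prime p \<and> p \<le> N. 1 - chi (int p) * of_real (real p powr -s))" for N
  define P2 where "P2 N = (\<Prod>p | prime p \<and> p \<le> N. 1 - chi (int p) ^ 2 * of_real (real p powr -s))" for N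
  have E0: "(\<lambda>N. P0 N * zeta) \<longlonglongrightarrow> 1"
    unfolding P0_def zeta_def by (rule Euler_product[OF _ _ zs]) (auto simp: powr_mult)
  have E1: "(\<lambda>N. P1 N * L s) \<longlonglongrightarrow> 1"
    unfolding P1_def by (rule L_Euler_product[OF s])
  have E2: "(\<lambda>N. P2 N * sq.L s) \<longlonglongrightarrow> 1"
    unfolding P2_def by (rule sq.L_Euler_product[OF s])
  have "(\<lambda>N. norm (P0 N * zeta) ^ 3 * norm (P1 N * L s) ^ 4 * norm (P2 N * sq.L s))
      \<longlonglongrightarrow> norm (1::complex) ^ 3 * norm (1::complex) ^ 4 * norm (1::complex)"
    by (intro tendsto_intros E0 E1 E2)
  moreover have "norm (P0 N * zeta) ^ 3 * norm (P1 N * L s) ^ 4 * norm (P2 N * sq.L s)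
      \<le> norm zeta ^ 3 * norm (L s) ^ 4 * norm (sq.L s)" for N
  proof -
    have "norm (P0 N) ^ 3 * norm (P1 N) ^ 4 * norm (P2 N) \<le> 1"
      unfolding P0_def P1_def P2_def prod_norm[symmetric] prod_power_distrib prod.distrib[symmetric]
    proof (rule prod_le_1)
      fix p assume "p \<in> {p. prime p \<and> p \<le> N}"
      then have "real p > 1"
        using prime_gt_1_nat by auto
      then have "real p powr -s < 1"
        using s powr_less_mono[of "-s" 0 "real p"] by simp
      then show "0 \<le> norm (1 - complex_of_real (real p powr -s)) ^ 3
          * norm (1 - chi (int p) * of_real (real p powr -s)) ^ 4
          * norm (1 - chi (int p) ^ 2 * of_real (real p powr -s)) \<and>
          norm (1 - complex_of_real (real p powr -s)) ^ 3
          * norm (1 - chi (int p) * of_real (real p powr -s)) ^ 4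
          * norm (1 - chi (int p) ^ 2 * of_real (real p powr -s)) \<le> 1"
        using norm_341_le_1[of "chi (int p)" "real p powr -s"] norm_eq_1[of "int p"] eq_0_iff[of "int p"]
        by auto
    qed
    then have "(norm (P0 N) ^ 3 * norm (P1 N) ^ 4 * norm (P2 N)) *
        (norm zeta ^ 3 * norm (L s) ^ 4 * norm (sq.L s)) \<le>
        1 * (norm zeta ^ 3 * norm (L s) ^ 4 * norm (sq.L s))"
      by (rule mult_right_mono) simp
    then show ?thesis
      by (simp add: norm_mult power_mult_distrib mult_ac)
  qed
  ultimately have "1 \<le> norm zeta ^ 3 * norm (L s) ^ 4 * norm (sq.L s)"
    by (intro tendsto_upperbound[where F = sequentially]) auto
  also have "\<dots> \<le> (s / (s - 1)) ^ 3 * (C * (s - 1)) ^ 4 * real n"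
  proof (intro mult_mono power_mono)
    have "(\<lambda>m. complex_of_real (real (Suc m) powr -s)) sums zeta"
      unfolding zeta_def
      by (rule has_sum_from_1_imp_sums[OF has_sum_infsum[OF abs_summable_summable[OF zs]]])
    then have "(\<lambda>N. norm (\<Sum>m<N. complex_of_real (real (Suc m) powr -s))) \<longlonglongrightarrow> norm zeta"
      unfolding sums_def by (rule tendsto_norm)
    moreover have "norm (\<Sum>m<N. complex_of_real (real (Suc m) powr -s)) \<le> s / (s - 1)" for N
      using sum_powr_le[OF s, of N] sum_norm_le[of "{..<N}" "\<lambda>m. complex_of_real (real (Suc m) powr -s)"
          "\<lambda>m. real (Suc m) powr -s"] by simp
    ultimately show "norm zeta \<le> s / (s - 1)"
      by (intro tendsto_upperbound[where F = sequentially]) auto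
    show "norm (L s) \<le> C * (s - 1)"
      unfolding C_def by (rule norm_L_le_linear[OF b(1) b' s L1])
    show "norm (sq.L s) \<le> real n"
      by (rule sq.norm_L_le[OF b s])
  qed (use s in auto)
  also have "\<dots> = s ^ 3 * C ^ 4 * real n * e"
    using e by (simp add: s_def power_mult_distrib power_divide field_simps eval_nat_numeral)
  also have "\<dots> \<le> 2 ^ 3 * C ^ 4 * real n * e"
    using e by (intro mult_right_mono power_mono) (auto simp: s_def)
  also have "\<dots> = D / (1 + D)"
    by (simp add: e_def D_def)
  also have "\<dots> < 1"
    using C0 by simp
  finally show False by simp
qed

theorem L1_nonzero:
  assumes "coprime b (int n)" "chi b \<noteq> 1"
  shows "(\<Sum>m. chi (int (Suc m)) / of_nat (Suc m)) \<noteq> 0"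
  using L1_nonzero_real[OF assms] L1_nonzero_nonreal by blast

end

subsection \<open>The cotangent sum of an odd character\<close>

text \<open>Logarithmic differentiation of Euler's reflection formula for Gamma.\<close>

lemma Digamma_reflection_real:
  fixes x :: real
  assumes x: "0 < x" "x < 1"
  shows "Digamma (1 - x) - Digamma x = pi * cot (pi * x)"
proof -
  \<comment> \<open>No \<open>y\<close> is excluded: at integers both sides are 0 by the default
    values of \<open>Gamma\<close> and of division. Hence both derivatives below belong to the same
    function.\<close>
  have refl: "Gamma y * Gamma (1 - y) = pi / sin (pi * y)" for y :: real
  proof -
    have "Gamma (complex_of_real y) * Gamma (of_real (1 - y)) = of_real pi / sin (of_real (pi * y))"
      using Gamma_reflection_complex[of "of_real y"] by simp
    then have "complex_of_real (Gamma y * Gamma (1 - y)) = of_real (pi / sin (pi * y))"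
      by (metis Gamma_complex_of_real sin_of_real of_real_mult of_real_divide)
    then show ?thesis by (simp only: of_real_eq_iff)
  qed
  have sin: "sin (pi * x) > 0"
    using x by (intro sin_gt_zero) auto
  have G: "Gamma x > 0" "Gamma (1 - x) > 0"
    using x by auto
  have nonpos: "x \<notin> \<int>\<^sub>\<le>\<^sub>0" "1 - x \<notin> \<int>\<^sub>\<le>\<^sub>0"
    using x by (auto elim!: nonpos_Ints_cases)
  have "((\<lambda>y. Gamma y * Gamma (1 - y)) has_real_derivative
      Gamma x * Gamma (1 - x) * (Digamma x - Digamma (1 - x))) (at x)"
    using nonpos by (auto intro!: derivative_eq_intros simp: algebra_simps)
  moreover have "((\<lambda>y. pi / sin (pi * y)) has_real_derivative
      - (pi * (pi * cos (pi * x))) / sin (pi * x) ^ 2) (at x)"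
    using sin by (auto intro!: derivative_eq_intros simp: power2_eq_square)
  ultimately have "Gamma x * Gamma (1 - x) * (Digamma x - Digamma (1 - x)) =
      - (pi * (pi * cos (pi * x))) / sin (pi * x) ^ 2"
    unfolding refl by (rule DERIV_unique)
  then have "pi / sin (pi * x) * (Digamma x - Digamma (1 - x)) =
      pi / sin (pi * x) * (- (pi * cot (pi * x)))"
    unfolding refl by (simp add: cot_def power2_eq_square)
  then have "Digamma x - Digamma (1 - x) = - (pi * cot (pi * x))"
    using sin by (metis mult_left_cancel divide_eq_0_iff pi_neq_zero less_irrefl)
  then show ?thesis by simp
qed

context dirichlet_character
begin

text \<open>The series over a single residue class diverges. Since \<open>chi\<close> sums to 0 over
  a period, subtracting 1/(k+1) in every class of block \<open>k\<close> changes nothing and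
  produces the series of \<open>Digamma (a / n)\<close>. The Euler constant that it brings in
  cancels for the same reason.\<close>

lemma L1_eq_Digamma_sum:
  assumes b: "coprime b (int n)" "chi b \<noteq> 1"
  shows "(\<Sum>m. chi (int (Suc m)) / of_nat (Suc m)) =
    - (\<Sum>a=1..<n. chi (int a) * of_real (Digamma (real a / real n))) / of_nat n"
proof -
  define S where "S = (\<Sum>m. chi (int (Suc m)) / of_nat (Suc m))"
  define E where "E a = Digamma (real a / real n) + euler_mascheroni" for a
  have n0: "n > 0" using n_gt_1 by simp
  have sum0: "(\<Sum>a=1..<n. chi (int a)) = 0"
  proof -
    have "(\<Sum>a<n. chi (int a)) = chi (int 0) + (\<Sum>a=1..<n. chi (int a))"
      using n0 by (simp add: sum.atLeast_Suc_lessThan flip: atLeast0LessThan)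
    then show ?thesis using sum_period_eq_0[OF b] by simp
  qed
  have "(\<lambda>m. chi (int (Suc m)) / of_nat (Suc m)) sums S"
    unfolding S_def using summable_L1[OF b] by (rule summable_sums)
  then have "(\<lambda>m. chi (int m) / of_nat m) sums S"
    by (subst (asm) sums_Suc_iff) simp
  then have "(\<lambda>k. \<Sum>m=k*n..<k*n+n. chi (int m) / of_nat m) sums S"
    using n0 by (rule sums_group)
  moreover have "(\<Sum>m=k*n..<k*n+n. chi (int m) / of_nat m) =
      (\<Sum>a=1..<n. chi (int a) * of_real (inverse (real (Suc k)) - inverse (real a / real n + real k))
        * (- 1 / of_nat n))" for k
  proof -
    have "(\<Sum>m=k*n..<k*n+n. chi (int m) / of_nat m) = (\<Sum>a=0..<n. chi (int (k*n+a)) / of_nat (k*n+a))"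
      by (subst sum.atLeastLessThan_shift_0) (simp add: add.commute)
    also have "\<dots> = (\<Sum>a=0..<n. chi (int a) / of_nat (k*n+a))"
      using periodic_mult[of "int _" "int k"] by (intro sum.cong) (auto simp: algebra_simps)
    also have "\<dots> = (\<Sum>a=1..<n. chi (int a) / of_nat (k*n+a))"
      using n0 by (simp add: sum.atLeast_Suc_lessThan)
    also have "\<dots> = (\<Sum>a=1..<n. chi (int a) * of_real (inverse (real a / real n + real k)) / of_nat n)"
    proof (rule sum.cong)
      fix a assume "a \<in> {1..<n}"
      have "inverse (real a / real n + real k) / real n = 1 / real (k * n + a)"
      proof -
        have "real a / real n + real k = real (k * n + a) / real n"
          using n0 by (simp add: field_simps)
        then show ?thesis
          using n0 by simp
      qed
      then have "complex_of_real (inverse (real a / real n + real k)) / of_nat n = 1 / of_nat (k*n+a)"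
        by (metis of_real_1 of_real_divide of_real_of_nat_eq)
      then show "chi (int a) / of_nat (k*n+a) =
          chi (int a) * of_real (inverse (real a / real n + real k)) / of_nat n"
        by (metis mult_1_right times_divide_eq_right)
    qed simp
    also have "\<dots> = (\<Sum>a=1..<n. chi (int a) * of_real (inverse (real a / real n + real k)) / of_nat n)
        - (\<Sum>a=1..<n. chi (int a)) * of_real (inverse (real (Suc k))) / of_nat n"
      unfolding sum0 by simp
    also have "\<dots> = (\<Sum>a=1..<n. chi (int a) * of_real (inverse (real (Suc k)) - inverse (real a / real n + real k))
        * (- 1 / of_nat n))"
      unfolding sum_distrib_right sum_divide_distrib sum_subtractf[symmetric]
      by (intro sum.cong refl) (simp add: diff_divide_distrib right_diff_distrib del: of_nat_Suc)
    finally show ?thesis .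
  qed
  moreover have "(\<lambda>k. \<Sum>a=1..<n. chi (int a)
        * of_real (inverse (real (Suc k)) - inverse (real a / real n + real k)) * (- 1 / of_nat n)) sums
      (\<Sum>a=1..<n. chi (int a) * of_real (E a) * (- 1 / of_nat n))"
  proof (intro sums_sum sums_mult sums_mult2 sums_of_real)
    fix a assume "a \<in> {1..<n}"
    then have "real a / real n \<noteq> 0" using n0 by simp
    from summable_sums[OF summable_Digamma[OF this]]
    show "(\<lambda>k. inverse (real (Suc k)) - inverse (real a / real n + real k)) sums E a"
      by (simp add: E_def Digamma_def)
  qed
  ultimately have "S = (\<Sum>a=1..<n. chi (int a) * of_real (E a) * (- 1 / of_nat n))"
    using sums_unique2 by force
  also have "\<dots> = - ((\<Sum>a=1..<n. chi (int a) * of_real (Digamma (real a / real n)))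
      + (\<Sum>a=1..<n. chi (int a)) * of_real euler_mascheroni) / of_nat n"
    unfolding sum_distrib_right sum.distrib[symmetric] sum_divide_distrib sum_negf[symmetric]
    by (intro sum.cong refl) (simp add: E_def distrib_left add_divide_distrib diff_divide_distrib)
  finally show ?thesis
    unfolding sum0 by (simp add: S_def)
qed

text \<open>Reflecting \<open>a\<close> to \<open>n - a\<close> antisymmetrises the Digamma sum
  \<open>T\<close>: oddness of \<open>chi\<close> and the reflection formula give 2T = -pi times the
  cotangent sum, while T is -n times the value at 1 of the L-series.\<close>

lemma cot_sum_nonzero:
  assumes odd: "chi (-1) = -1"
  shows "(\<Sum>a=1..<n. chi (int a) * of_real (cot (pi * (real a / real n)))) \<noteq> 0"
proof
  assume 0: "(\<Sum>a=1..<n. chi (int a) * of_real (cot (pi * (real a / real n)))) = 0"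
  have b: "coprime (-1) (int n)" "chi (-1) \<noteq> 1"
    using odd by auto
  define T where "T = (\<Sum>a=1..<n. chi (int a) * of_real (Digamma (real a / real n)))"
  have neg: "chi (- a) = - chi a" for a
    using mult[of "-1" a] odd by simp
  have "T = (\<Sum>a=1..<n. chi (int (n - a)) * of_real (Digamma (real (n - a) / real n)))"
    unfolding T_def by (rule sum.reindex_bij_witness[of _ "\<lambda>a. n - a" "\<lambda>a. n - a"]) auto
  also have "\<dots> = (\<Sum>a=1..<n. - chi (int a) * of_real (Digamma (1 - real a / real n)))"
  proof (rule sum.cong)
    fix a assume a: "a \<in> {1..<n}"
    then have "chi (int (n - a)) = - chi (int a)"
      using periodic[of "- int a"] neg by simp
    moreover have "real (n - a) / real n = 1 - real a / real n"
      using a by (simp add: diff_divide_distrib)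
    ultimately show "chi (int (n - a)) * of_real (Digamma (real (n - a) / real n)) =
        - chi (int a) * of_real (Digamma (1 - real a / real n))"
      by simp
  qed simp
  finally have "T + T = (\<Sum>a=1..<n. - chi (int a) * of_real (Digamma (1 - real a / real n))) + T"
    by simp
  also have "\<dots> = (\<Sum>a=1..<n. - of_real pi * (chi (int a) * of_real (cot (pi * (real a / real n)))))"
    unfolding T_def sum.distrib[symmetric]
  proof (rule sum.cong)
    fix a assume a: "a \<in> {1..<n}"
    have "- chi (int a) * of_real (Digamma (1 - real a / real n)) + chi (int a) * of_real (Digamma (real a / real n))
        = - chi (int a) * of_real (Digamma (1 - real a / real n) - Digamma (real a / real n))"
      by (simp add: algebra_simps)
    also have "Digamma (1 - real a / real n) - Digamma (real a / real n) = pi * cot (pi * (real a / real n))"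
      using a by (intro Digamma_reflection_real) auto
    finally show "- chi (int a) * of_real (Digamma (1 - real a / real n)) + chi (int a) * of_real (Digamma (real a / real n))
        = - of_real pi * (chi (int a) * of_real (cot (pi * (real a / real n))))"
      by simp
  qed simp
  also have "\<dots> = 0"
    unfolding sum_distrib_left[symmetric] 0 by simp
  finally have "T = 0"
    by simp
  then show False
    using L1_nonzero[OF b] L1_eq_Digamma_sum[OF b] by (simp add: T_def)
qed

end

subsection \<open>The sine transform of the first Bernoulli function\<close>

lemma sum_sin_multiples:
  "2 * sin h * (\<Sum>k<N. sin (2 * real k * h)) = cos h - cos ((2 * real N - 1) * h)"
proof (induction N)
  case (Suc N)
  have "2 * sin h * sin (2 * real N * h) = cos (2 * real N * h - h) - cos (2 * real N * h + h)"
    by (simp add: cos_diff cos_add)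
  then show ?case
    using Suc by (simp add: algebra_simps)
qed simp

text \<open>The denominator is cleared so that the closed form holds for every \<open>h\<close> and
  the induction needs no case distinction; real subtraction in \<open>real N - 1\<close> covers
  \<open>N = 0\<close>.\<close>

lemma sum_mult_sin_multiples:
  "4 * sin h ^ 2 * (\<Sum>k<N. real k * sin (2 * real k * h)) =
    sin (2 * (real N - 1) * h) - 2 * (real N - 1) * sin h * cos ((2 * real N - 1) * h)"
proof (induction N)
  case 0
  have "sin (2 * h) = 2 * sin h * cos h" by (rule sin_double)
  then show ?case by simp
next
  case (Suc N)
  define x where "x = 2 * real N * h"
  have e1: "2 * (real N - 1) * h = x - 2 * h" "(2 * real N - 1) * h = x - h"
    "2 * (real (Suc N) - 1) * h = x" "(2 * real (Suc N) - 1) * h = x + h"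
    by (simp_all add: x_def algebra_simps)
  have c2: "cos (2 * h) = 1 - 2 * sin h ^ 2" by (simp add: cos_double_sin)
  have "4 * sin h ^ 2 * (\<Sum>k<Suc N. real k * sin (2 * real k * h)) =
      sin (x - 2 * h) - 2 * (real N - 1) * sin h * cos (x - h) + 4 * sin h ^ 2 * (real N * sin x)"
    using Suc.IH unfolding e1 by (simp add: distrib_left x_def)
  also have "\<dots> = sin x - 2 * real N * sin h * cos (x + h)"
    unfolding sin_diff cos_diff cos_add c2 sin_double by (simp add: algebra_simps power2_eq_square)
  finally show ?case
    unfolding e1 by simp
qed

text \<open>For h = pi a/n the product n h is a multiple of pi, so the plain sine sum vanishes and
  the one weighted by k becomes -(n/2) cot h. At \<open>k = 0\<close> the linear formula gives -1/2
  instead of the value 0 of \<open>bernoulli1\<close>, which is harmless because the sine is 0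
  there.\<close>

lemma bernoulli1_sine_transform:
  fixes a :: int
  assumes n: "n > 0" and a: "\<not> int n dvd a"
  shows "(\<Sum>k<n. bernoulli1 (real k / real n) * sin (2 * pi * real k * of_int a / real n))
    = - cot (pi * (of_int a / real n)) / 2"
proof -
  define h where "h = pi * (of_int a / real n)"
  have nh: "real n * h = pi * of_int a"
    using n by (simp add: h_def)
  have sin_h: "sin h \<noteq> 0"
  proof
    assume "sin h = 0"
    then obtain i where "h = of_int i * pi"
      by (auto simp: sin_zero_iff_int2)
    then have "pi * of_int a = pi * of_int (int n * i)"
      using nh by (simp add: mult_ac)
    then have "a = int n * i"
      by (simp only: mult_cancel_left pi_neq_zero of_int_eq_iff simp_thms)
    then show False using a by simp
  qed
  have per: "cos ((2 * real n - 1) * h) = cos h" "sin (2 * (real n - 1) * h) = - sin (2 * h)"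
  proof -
    have "(2 * real n - 1) * h = 2 * pi * of_int a - h" "2 * (real n - 1) * h = 2 * pi * of_int a - 2 * h"
      using nh by (simp_all add: algebra_simps)
    then show "cos ((2 * real n - 1) * h) = cos h" "sin (2 * (real n - 1) * h) = - sin (2 * h)"
      by (simp_all add: cos_diff sin_diff)
  qed
  have s0: "(\<Sum>k<n. sin (2 * real k * h)) = 0"
    using sum_sin_multiples[of h n] sin_h per by simp
  have s1': "4 * sin h ^ 2 * (\<Sum>k<n. real k * sin (2 * real k * h)) = - 2 * real n * (sin h * cos h)"
    unfolding sum_mult_sin_multiples per sin_double by (simp add: algebra_simps)
  have s1: "(\<Sum>k<n. real k * sin (2 * real k * h)) = - (real n / 2) * cot h"
  proof -
    define S where "S = (\<Sum>k<n. real k * sin (2 * real k * h))"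
    have "sin h * (2 * sin h * S) = sin h * (- real n * cos h)"
      using s1' unfolding S_def[symmetric] by (simp add: power2_eq_square algebra_simps)
    then have "2 * sin h * S = - real n * cos h"
      using sin_h by (simp only: mult_cancel_left simp_thms)
    then show ?thesis
      using sin_h unfolding S_def[symmetric] by (simp add: cot_def field_simps)
  qed
  have "(\<Sum>k<n. bernoulli1 (real k / real n) * sin (2 * pi * real k * of_int a / real n))
      = (\<Sum>k<n. (real k / real n - 1 / 2) * sin (2 * real k * h))"
  proof (rule sum.cong)
    fix k assume k: "k \<in> {..<n}"
    have arg: "2 * pi * real k * of_int a / real n = 2 * real k * h"
      by (simp add: h_def)
    show "bernoulli1 (real k / real n) * sin (2 * pi * real k * of_int a / real n)
        = (real k / real n - 1 / 2) * sin (2 * real k * h)"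
    proof (cases "k = 0")
      case False
      then have *: "0 < real k / real n" "real k / real n < 1"
        using k by auto
      then have "real k / real n \<notin> \<int>"
        by (metis Ints_cases of_int_0_less_iff of_int_less_1_iff zless_imp_add1_zle
            add_0 not_less)
      moreover have "frac (real k / real n) = real k / real n"
        using * by (simp add: frac_eq)
      ultimately show ?thesis
        unfolding arg by (simp add: bernoulli1_def)
    qed simp
  qed simp
  also have "\<dots> = (\<Sum>k<n. real k * sin (2 * real k * h)) / real n - (\<Sum>k<n. sin (2 * real k * h)) / 2"
    by (simp add: left_diff_distrib sum_subtractf sum_divide_distrib)
  also have "\<dots> = - cot h / 2"
    using n unfolding s0 s1 by simp
  finally show ?thesis
    by (simp add: h_def)
qed

subsection \<open>Odd functions orthogonal to all Bernoulli values\<close>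

lemma unit_group_eq:
  assumes "n > 1"
  shows "unit_group n = {x. 0 < x \<and> x < int n \<and> coprime x (int n)}"
proof -
  interpret residues "int n" "residue_ring (int n)"
    using assms by unfold_locales auto
  show ?thesis
    by (simp add: unit_group_def res_units_eq)
qed

lemma finite_unit_group: "n > 1 \<Longrightarrow> finite (unit_group n)"
  by (rule finite_subset[of _ "{0..<int n}"]) (auto simp: unit_group_eq)

lemma mod_in_unit_group:
  assumes "n > 1" "coprime a (int n)"
  shows "a mod int n \<in> unit_group n"
proof -
  have "coprime (a mod int n) (int n)"
    using assms by simp
  moreover from this have "a mod int n \<noteq> 0"
    using assms(1) by auto
  then have "0 < a mod int n"
    using pos_mod_sign[of "int n" a] assms(1) by linarith
  ultimately show ?thesis
    using assms by (auto simp: unit_group_eq)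
qed

lemma bij_betw_mult_mod_unit_group:
  assumes "n > 1" "coprime h (int n)"
  shows "bij_betw (\<lambda>g. (g * h) mod int n) (unit_group n) (unit_group n)"
proof -
  have "unit_group n \<subseteq> {0..<int n}"
    using assms by (auto simp: unit_group_eq)
  moreover have "inj_on (\<lambda>g. (g * h) mod int n) {0..<int n}"
    using bij_betw_mult_mod_residues[of h n] assms by (simp add: bij_betw_def)
  ultimately have "inj_on (\<lambda>g. (g * h) mod int n) (unit_group n)"
    by (rule inj_on_subset[rotated])
  moreover have "(\<lambda>g. (g * h) mod int n) ` unit_group n \<subseteq> unit_group n"
  proof safe
    fix g assume "g \<in> unit_group n"
    then show "g * h mod int n \<in> unit_group n"
      using assms by (intro mod_in_unit_group) (auto simp: unit_group_eq)
  qed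
  ultimately show ?thesis
    using finite_unit_group[OF assms(1)] by (simp add: bij_betw_def endo_inj_surj)
qed

lemma bij_betw_modular_inverse:
  assumes n: "n > 1"
  shows "bij_betw (modular_inverse (int n)) (unit_group n) (unit_group n)"
proof (rule bij_betwI[of _ _ _ "modular_inverse (int n)"])
  have in_U: "modular_inverse (int n) g \<in> unit_group n" if "g \<in> unit_group n" for g
    using that n mult_modular_inverse_int_pos[of "int n" g] modular_inverse_int_less[of "int n" g]
    by (auto simp: unit_group_eq)
  then show "modular_inverse (int n) \<in> unit_group n \<rightarrow> unit_group n"
    and "modular_inverse (int n) \<in> unit_group n \<rightarrow> unit_group n"
    by auto
  have "modular_inverse (int n) (modular_inverse (int n) g) = g" if "g \<in> unit_group n" for g
    using that n cong_modular_inverse2[of g "int n"]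
    by (intro modular_inverse_int_eqI) (auto simp: unit_group_eq)
  then show "modular_inverse (int n) (modular_inverse (int n) g) = g"
    "modular_inverse (int n) (modular_inverse (int n) g) = g" if "g \<in> unit_group n" for g
    using that by auto
qed

lemma bernoulli1_cong:
  assumes "n > 0" "[a = b] (mod int n)"
  shows "bernoulli1 (of_int a / of_nat n) = bernoulli1 (of_int b / of_nat n)"
proof -
  have "1 / real n \<in> frac_multiples n"
    by (auto simp: frac_multiples_def intro: exI[of _ 1])
  from bernoulli1_well_defined[OF assms(1) this _ assms(2), of "1 / real n"] show ?thesis
    by simp
qed

lemma sin_cong:
  fixes a b :: int
  assumes "n > 0" "[a = b] (mod int n)"
  shows "sin (2 * pi * of_int a / real n) = sin (2 * pi * of_int b / real n)"
proof -
  obtain k where k: "b = a + int n * k"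
    using assms(2) by (auto simp: cong_iff_lin)
  have "2 * pi * of_int b / real n = 2 * pi * of_int a / real n + 2 * pi * of_int k"
    using assms(1) by (simp add: k field_simps)
  then show ?thesis
    by (simp add: sin_add)
qed

text \<open>Substituting k = j i with i the inverse of \<open>g\<close> moves the dilation from the
  Bernoulli function to the sine, so the cotangent is taken at the inverse.\<close>

lemma bernoulli1_dilated_sine_transform:
  assumes n: "n > 1" and g: "coprime g (int n)"
  shows "(\<Sum>k\<in>{0..<int n}. sin (2 * pi * of_int k / real n) * bernoulli1 (of_int (g * k) / real n))
    = - cot (pi * (of_int (modular_inverse (int n) g) / real n)) / 2"
proof -
  define i where "i = modular_inverse (int n) g"
  have n0: "n > 0" using n by simp
  have gi: "[g * i = 1] (mod int n)"
    unfolding i_def using g by (rule cong_modular_inverse1)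
  have i: "coprime i (int n)"
    unfolding i_def using g by auto
  have ndvd: "\<not> int n dvd i"
    using coprime_common_divisor[OF i, of "int n"] n by auto
  let ?F = "\<lambda>k. sin (2 * pi * of_int k / real n) * bernoulli1 (of_int (g * k) / real n)"
  have "(\<Sum>k\<in>{0..<int n}. ?F k) = (\<Sum>j\<in>{0..<int n}. ?F ((j * i) mod int n))"
    using sum.reindex_bij_betw[OF bij_betw_mult_mod_residues[OF i n0], of ?F] by simp
  also have "\<dots> = (\<Sum>j\<in>{0..<int n}. bernoulli1 (of_int j / real n) * sin (2 * pi * of_int j * of_int i / real n))"
  proof (rule sum.cong)
    fix j
    have "[g * ((j * i) mod int n) = g * (j * i)] (mod int n)"
      by (intro cong_mult) auto
    also have "g * (j * i) = g * i * j"
      by simp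
    also have "[g * i * j = 1 * j] (mod int n)"
      using gi by (intro cong_mult) auto
    finally have "bernoulli1 (of_int (g * ((j * i) mod int n)) / real n) = bernoulli1 (of_int j / real n)"
      unfolding mult_1_left by (rule bernoulli1_cong[OF n0])
    moreover have "sin (2 * pi * of_int ((j * i) mod int n) / real n) = sin (2 * pi * of_int (j * i) / real n)"
      by (rule sin_cong[OF n0]) simp
    ultimately show "?F ((j * i) mod int n) =
        bernoulli1 (of_int j / real n) * sin (2 * pi * of_int j * of_int i / real n)"
      by (simp add: mult_ac)
  qed simp
  also have "\<dots> = (\<Sum>k<n. bernoulli1 (real k / real n) * sin (2 * pi * real k * of_int i / real n))"
    by (rule sum.reindex_bij_witness[of _ int nat]) auto
  also have "\<dots> = - cot (pi * (of_int i / real n)) / 2"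
    by (rule bernoulli1_sine_transform[OF n0 ndvd])
  finally show ?thesis
    by (simp add: i_def)
qed

context dirichlet_character
begin

lemma chi_modular_inverse:
  assumes "coprime g (int n)"
  shows "chi g = cnj (chi (modular_inverse (int n) g))"
proof -
  let ?i = "modular_inverse (int n) g"
  have "chi g * chi ?i = 1"
    using eq_if_cong[OF cong_modular_inverse1[OF assms]] by (simp add: mult)
  moreover have "chi ?i * cnj (chi ?i) = 1"
    using norm_eq_1[of ?i] assms by (simp flip: complex_norm_square)
  ultimately show ?thesis
    by (metis mult.assoc mult.commute mult_1_right)
qed

text \<open>If all these sums vanished, so would their combination with weights sin(2 pi k/n). In it
  each \<open>g\<close> contributes a cotangent at the inverse of \<open>g\<close>; after inverting
  the summation variable this is -1/2 times the cotangent sum of the conjugate character, which is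
  odd as well.\<close>

lemma odd_bernoulli_sum_nonzero:
  assumes odd: "chi (-1) = -1"
  shows "\<exists>k::int. (\<Sum>g\<in>unit_group n. chi g * of_real (bernoulli1 (of_int (g * k) / real n))) \<noteq> 0"
proof (rule ccontr)
  assume "\<not> ?thesis"
  then have zero: "(\<Sum>g\<in>unit_group n. chi g * of_real (bernoulli1 (of_int (g * k) / real n))) = 0" for k
    by blast
  interpret cnj: dirichlet_character n "\<lambda>a. cnj (chi a)"
    by (rule conj)
  let ?i = "modular_inverse (int n)"
  let ?cot = "\<lambda>g. complex_of_real (cot (pi * (of_int g / real n)))"
  have "0 = (\<Sum>k\<in>{0..<int n}. of_real (sin (2 * pi * of_int k / real n)) *
      (\<Sum>g\<in>unit_group n. chi g * of_real (bernoulli1 (of_int (g * k) / real n))))"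
    by (simp only: zero mult_zero_right sum.neutral_const)
  also have "\<dots> = (\<Sum>g\<in>unit_group n. \<Sum>k\<in>{0..<int n}. chi g * of_real (sin (2 * pi * of_int k / real n)
      * bernoulli1 (of_int (g * k) / real n)))"
    unfolding sum_distrib_left by (subst sum.swap) (simp add: mult_ac)
  also have "\<dots> = (\<Sum>g\<in>unit_group n. cnj (chi (?i g)) * (- ?cot (?i g) / 2))"
  proof (rule sum.cong)
    fix g assume "g \<in> unit_group n"
    then have g: "coprime g (int n)"
      using n_gt_1 by (simp add: unit_group_eq)
    have "(\<Sum>k\<in>{0..<int n}. chi g * of_real (sin (2 * pi * of_int k / real n) * bernoulli1 (of_int (g * k) / real n)))
        = chi g * of_real (\<Sum>k\<in>{0..<int n}. sin (2 * pi * of_int k / real n) * bernoulli1 (of_int (g * k) / real n))"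
      by (simp only: of_real_sum sum_distrib_left)
    also have "\<dots> = cnj (chi (?i g)) * of_real (- cot (pi * (of_int (?i g) / real n)) / 2)"
      unfolding bernoulli1_dilated_sine_transform[OF n_gt_1 g]
      by (simp only: chi_modular_inverse[OF g])
    finally show "(\<Sum>k\<in>{0..<int n}. chi g * of_real (sin (2 * pi * of_int k / real n) * bernoulli1 (of_int (g * k) / real n)))
        = cnj (chi (?i g)) * (- ?cot (?i g) / 2)"
      by (simp only: of_real_divide of_real_minus of_real_numeral)
  qed simp
  also have "\<dots> = (\<Sum>g\<in>unit_group n. cnj (chi g) * (- ?cot g / 2))"
    by (rule sum.reindex_bij_betw[OF bij_betw_modular_inverse[OF n_gt_1]])
  also have "\<dots> = (\<Sum>g\<in>{1..<int n}. cnj (chi g) * (- ?cot g / 2))"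
  proof (rule sum.mono_neutral_left)
    show "unit_group n \<subseteq> {1..<int n}"
      using n_gt_1 by (auto simp: unit_group_eq)
    show "\<forall>g\<in>{1..<int n} - unit_group n. cnj (chi g) * (- ?cot g / 2) = 0"
    proof
      fix g assume "g \<in> {1..<int n} - unit_group n"
      then have "\<not> coprime g (int n)"
        using n_gt_1 by (auto simp: unit_group_eq)
      then have "chi g = 0"
        using eq_0_iff by blast
      then show "cnj (chi g) * (- ?cot g / 2) = 0"
        by simp
    qed
  qed simp
  also have "\<dots> = (\<Sum>a=1..<n. cnj (chi (int a)) * (- ?cot (int a) / 2))"
    by (rule sum.reindex_bij_witness[of _ int nat]) auto
  also have "\<dots> = (\<Sum>a=1..<n. cnj (chi (int a)) * of_real (cot (pi * (real a / real n)))) * (- 1 / 2)"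
    unfolding sum_distrib_right by (intro sum.cong) auto
  finally show False
    using cnj.cot_sum_nonzero odd by simp
qed

end

lemma root_of_unity_sum:
  assumes "j < N"
  shows "(\<Sum>l<N. exp (2 * of_real pi * \<i> * of_nat j / of_nat N) ^ l) = (if j = 0 then of_nat N else 0 :: complex)"
proof (cases "j = 0")
  case False
  let ?z = "exp (2 * of_real pi * \<i> * of_nat j / of_nat N) :: complex"
  have "?z \<noteq> 1"
    using assms False complex_root_unity_eq_1[of N j] by (auto dest: dvd_imp_le)
  moreover have "?z ^ N = 1"
    using assms by (intro complex_root_unity) auto
  ultimately show ?thesis
    using False by (simp add: geometric_sum)
qed auto

text \<open>
  A simultaneous eigenvector of the dilations is a multiple of a character; it is found by
  applying, for one dilation \<open>h\<close> after the other, a projection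
  \<open>f \<mapsto> (\<lambda>a. \<Sum>j. \<zeta> ^ j * f (h ^ j * a))\<close> onto an eigenspace of \<open>h\<close>.
\<close>

lemma exists_character_in_dilation_invariant_space:
  fixes W :: "(int \<Rightarrow> complex) set"
  assumes n: "n > 1"
    and add: "\<And>f g. f \<in> W \<Longrightarrow> g \<in> W \<Longrightarrow> (\<lambda>a. f a + g a) \<in> W"
    and scale: "\<And>f c. f \<in> W \<Longrightarrow> (\<lambda>a. c * f a) \<in> W"
    and dilate: "\<And>f h. f \<in> W \<Longrightarrow> coprime h (int n) \<Longrightarrow> (\<lambda>a. f (h * a)) \<in> W"
    and cong: "\<And>f a b. f \<in> W \<Longrightarrow> [a = b] (mod int n) \<Longrightarrow> f a = f b"
    and supp: "\<And>f a. f \<in> W \<Longrightarrow> \<not> coprime a (int n) \<Longrightarrow> f a = 0"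
    and f0: "f0 \<in> W" "f0 a0 \<noteq> 0"
  obtains chi where "dirichlet_character n chi" "chi \<in> W"
proof -
  have sums: "(\<lambda>a. \<Sum>j<N. c j * f (h ^ j * a)) \<in> W" if "f \<in> W" "coprime h (int n)" for f h c and N :: nat
  proof (induction N)
    case 0
    then show ?case using scale[OF that(1), of 0] by simp
  next
    case (Suc N)
    show ?case
      using add[OF Suc scale[OF dilate[OF that(1), of "h ^ N"], of "c N"]] that(2) by simp
  qed
  have "\<exists>f\<in>W. (\<exists>a. f a \<noteq> 0) \<and> (\<forall>h\<in>A. \<exists>c. \<forall>a. f (h * a) = c * f a)"
    if "finite A" "\<And>h. h \<in> A \<Longrightarrow> coprime h (int n)" for A
    using that
  proof (induction A rule: finite_induct)
    case empty
    then show ?case using f0 by auto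
  next
    case (insert h A)
    then obtain f where f: "f \<in> W" "\<exists>a. f a \<noteq> 0" and eig: "\<forall>h\<in>A. \<exists>c. \<forall>a. f (h * a) = c * f a"
      by auto
    have h: "coprime h (int n)" using insert.prems by simp
    define N where "N = totient n"
    have N: "N > 0" using n by (simp add: N_def)
    have hN: "[h ^ N = 1] (mod int n)"
    proof -
      interpret residues "int n" "residue_ring (int n)"
        using n by unfold_locales auto
      show ?thesis
        using euler_theorem[OF h] by (simp add: N_def)
    qed
    define z where "z j = exp (2 * of_real pi * \<i> * of_nat j / of_nat N)" for j :: nat
    have z_swap: "z l ^ j = z j ^ l" for l j
      by (simp add: z_def mult_ac flip: exp_of_nat_mult)
    have zN: "z l ^ N = 1" for l
      unfolding z_def using N by (intro complex_root_unity) auto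
    \<comment> \<open>Since \<open>h ^ N\<close> is 1 modulo \<open>n\<close>, the N-th power of the
      dilation is the identity on \<open>W\<close>. Up to a factor 1/N, \<open>P l\<close> is the
      projection to the eigenvalue \<open>1 / z l\<close>; all of them add up to \<open>N\<close>
      times \<open>f\<close>, so one is nonzero.\<close>
    define P where "P l = (\<lambda>a. \<Sum>j<N. z l ^ j * f (h ^ j * a))" for l
    have PW: "P l \<in> W" for l
      unfolding P_def using f(1) h by (rule sums)
    have "(\<Sum>l<N. P l a) = of_nat N * f a" for a
    proof -
      have "(\<Sum>l<N. P l a) = (\<Sum>j<N. (\<Sum>l<N. z l ^ j) * f (h ^ j * a))"
        unfolding P_def sum_distrib_right by (rule sum.swap)
      also have "\<dots> = (\<Sum>j<N. if j = 0 then of_nat N * f a else 0)"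
      proof (rule sum.cong)
        fix j assume "j \<in> {..<N}"
        then have "(\<Sum>l<N. z l ^ j) = (if j = 0 then of_nat N else 0)"
          unfolding z_swap[of _ j] unfolding z_def by (intro root_of_unity_sum) simp
        then show "(\<Sum>l<N. z l ^ j) * f (h ^ j * a) = (if j = 0 then of_nat N * f a else 0)"
          by simp
      qed simp
      also have "\<dots> = of_nat N * f a"
        using N by simp
      finally show ?thesis .
    qed
    then obtain l where l: "\<exists>a. P l a \<noteq> 0"
      using f(2) N by (metis mult_eq_0_iff of_nat_eq_0_iff less_irrefl sum.neutral)
    have z0: "z l \<noteq> 0" by (simp add: z_def)
    have eig_h: "P l (h * a) = (1 / z l) * P l a" for a
    proof -
      let ?t = "\<lambda>j. z l ^ j * f (h ^ j * a)"
      have "z l * P l (h * a) = (\<Sum>j<N. ?t (Suc j))"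
        by (simp add: P_def sum_distrib_left mult_ac)
      also have "?t 0 + \<dots> = (\<Sum>j<Suc N. ?t j)"
        by (rule sum.lessThan_Suc_shift[symmetric])
      also have "\<dots> = P l a + ?t N"
        by (simp add: P_def)
      also have "?t N = ?t 0"
        using cong[OF f(1) cong_scalar_right[OF hN, of a]] zN by simp
      finally have "z l * P l (h * a) = P l a"
        by simp
      then show ?thesis using z0 by (simp add: field_simps)
    qed
    \<comment> \<open>Dilations commute, so the eigenvalue relations already secured for
      \<open>A\<close> survive the projection.\<close>
    have "\<exists>c. \<forall>a. P l (h' * a) = c * P l a" if h': "h' \<in> A" for h'
    proof -
      obtain c where c: "\<forall>a. f (h' * a) = c * f a"
        using bspec[OF eig h'] by (rule exE)
      have "P l (h' * a) = c * P l a" for a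
      proof -
        have "f (h ^ j * (h' * a)) = c * f (h ^ j * a)" for j
          using spec[OF c, of "h ^ j * a"] by (simp only: mult.left_commute)
        then show ?thesis
          unfolding P_def sum_distrib_left by (intro sum.cong) (simp_all only: mult.left_commute)
      qed
      then show ?thesis by blast
    qed
    then show ?case
      using PW[of l] l eig_h by blast
  qed
  from this[OF finite_unit_group[OF n]] obtain f where f: "f \<in> W" "\<exists>a. f a \<noteq> 0"
    and eig': "\<forall>h\<in>unit_group n. \<exists>c. \<forall>a. f (h * a) = c * f a"
    using n by (auto simp: unit_group_eq)
  have eig: "\<exists>c. \<forall>a. f (h * a) = c * f a" if h: "coprime h (int n)" for h
  proof -
    obtain c where c: "\<forall>a. f ((h mod int n) * a) = c * f a"
      using bspec[OF eig' mod_in_unit_group[OF n h]] by (rule exE)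
    have "f (h * a) = f ((h mod int n) * a)" for a
      by (rule cong[OF f(1)]) (simp add: cong_scalar_right cong_sym)
    then have "\<forall>a. f (h * a) = c * f a"
      using c by (simp only:) simp
    then show ?thesis by (rule exI)
  qed
  \<comment> \<open>The value \<open>f a\<close> at a unit is the eigenvalue of the dilation by
    \<open>a\<close> times \<open>f 1\<close>. Hence \<open>f 1\<close> cannot vanish, and
    \<open>f\<close> divided by \<open>f 1\<close> is the eigenvalue as a function of
    \<open>a\<close>, which is multiplicative.\<close>
  have f1: "f 1 \<noteq> 0"
  proof -
    obtain a where a: "f a \<noteq> 0" using f(2) by blast
    then have "coprime a (int n)" using supp[OF f(1)] by blast
    from eig[OF this] obtain c where "\<forall>x. f (a * x) = c * f x" by (rule exE)
    from spec[OF this, of 1] have "f a = c * f 1" by simp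
    then show ?thesis using a by auto
  qed
  have mult: "f (a * b) * f 1 = f a * f b" for a b
  proof (cases "coprime a (int n)")
    case True
    from eig[OF this] obtain c where c: "\<forall>x. f (a * x) = c * f x" by (rule exE)
    from spec[OF c, of 1] spec[OF c, of b] show ?thesis by simp
  next
    case False
    then show ?thesis using supp[OF f(1)] by simp
  qed
  have nonzero: "f a \<noteq> 0" if "coprime a (int n)" for a
  proof
    assume "f a = 0"
    then have "f (a * modular_inverse (int n) a) = 0"
      using mult[of a "modular_inverse (int n) a"] f1 by simp
    then show False
      using cong[OF f(1) cong_modular_inverse1[OF that]] f1 by simp
  qed
  have "dirichlet_character n (\<lambda>a. (1 / f 1) * f a)"
  proof
    fix a b
    show "(1 / f 1) * f (a * b) = (1 / f 1) * f a * ((1 / f 1) * f b)"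
      using mult[of a b] f1 by (simp add: field_simps)
    show "(1 / f 1) * f (a + int n) = (1 / f 1) * f a"
      using cong[OF f(1), of "a + int n" a] by (simp add: Cong.cong_def)
    show "((1 / f 1) * f a = 0) = (\<not> coprime a (int n))"
      using nonzero[of a] supp[OF f(1), of a] f1 by auto
  qed (use n f1 in auto)
  then show ?thesis
    using that scale[OF f(1), of "1 / f 1"] by blast
qed

lemma odd_orthogonal_to_bernoulli_eq_0:
  fixes F :: "int \<Rightarrow> complex"
  assumes n: "n > 1"
    and cong: "\<And>a b. [a = b] (mod int n) \<Longrightarrow> F a = F b"
    and supp: "\<And>a. \<not> coprime a (int n) \<Longrightarrow> F a = 0"
    and odd: "\<And>a. F (- a) = - F a"
    and orth: "\<And>k::int. (\<Sum>g\<in>unit_group n. F g * of_real (bernoulli1 (of_int (g * k) / real n))) = 0"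
  shows "F a = 0"
proof (rule ccontr)
  assume "F a \<noteq> 0"
  define W :: "(int \<Rightarrow> complex) set" where
    "W = {f. (\<forall>a b. [a = b] (mod int n) \<longrightarrow> f a = f b) \<and> (\<forall>a. \<not> coprime a (int n) \<longrightarrow> f a = 0)
      \<and> (\<forall>a. f (- a) = - f a)
      \<and> (\<forall>k::int. (\<Sum>g\<in>unit_group n. f g * of_real (bernoulli1 (of_int (g * k) / real n))) = 0)}"
  have "F \<in> W"
    using cong supp odd orth by (simp add: W_def)
  obtain chi where chi: "dirichlet_character n chi" "chi \<in> W"
  proof (rule exists_character_in_dilation_invariant_space[of n W F a])
    show "(\<lambda>a. f a + g a) \<in> W" if "f \<in> W" "g \<in> W" for f g
      using that unfolding W_def by (auto simp: distrib_right sum.distrib)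
    show "(\<lambda>a. c * f a) \<in> W" if "f \<in> W" for f c
      using that unfolding W_def by (auto simp: mult.assoc simp flip: sum_distrib_left)
    show "f a = f b" if "f \<in> W" "[a = b] (mod int n)" for f a b
      using that by (simp add: W_def)
    show "f a = 0" if "f \<in> W" "\<not> coprime a (int n)" for f a
      using that by (simp add: W_def)
    show "(\<lambda>a. f (h * a)) \<in> W" if f: "f \<in> W" and h: "coprime h (int n)" for f h
    proof -
      have fcong: "f a = f b" if "[a = b] (mod int n)" for a b
        using f that by (simp add: W_def)
      have "(\<Sum>g\<in>unit_group n. f (h * g) * of_real (bernoulli1 (of_int (g * k) / real n))) = 0" for k
      proof -
        \<comment> \<open>Substituting u = g h turns the relation of the dilated function at
          \<open>k\<close> into the relation of \<open>f\<close> at \<open>?h * k\<close>, which is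
          among those defining \<open>W\<close>.\<close>
        let ?h = "modular_inverse (int n) h"
        let ?G = "\<lambda>u. f u * of_real (bernoulli1 (of_int (u * (?h * k)) / real n))"
        have "(\<Sum>g\<in>unit_group n. f (h * g) * of_real (bernoulli1 (of_int (g * k) / real n))) =
            (\<Sum>g\<in>unit_group n. ?G ((g * h) mod int n))"
        proof (rule sum.cong)
          fix g
          have "f (h * g) = f ((g * h) mod int n)"
            by (rule fcong) (simp add: mult.commute cong_sym)
          moreover have "[(g * h) mod int n * (?h * k) = g * k] (mod int n)"
          proof -
            have "[(g * h) mod int n * (?h * k) = g * h * (?h * k)] (mod int n)"
              by (intro cong_mult) auto
            also have "g * h * (?h * k) = h * ?h * (g * k)"
              by simp
            also have "[h * ?h * (g * k) = 1 * (g * k)] (mod int n)"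
              by (intro cong_mult cong_modular_inverse1 h) auto
            finally show ?thesis by simp
          qed
          then have "bernoulli1 (of_int ((g * h) mod int n * (?h * k)) / real n) = bernoulli1 (of_int (g * k) / real n)"
            using n by (intro bernoulli1_cong) auto
          ultimately show "f (h * g) * of_real (bernoulli1 (of_int (g * k) / real n)) = ?G ((g * h) mod int n)"
            by (simp only:)
        qed simp
        also have "\<dots> = (\<Sum>u\<in>unit_group n. ?G u)"
          by (rule sum.reindex_bij_betw[OF bij_betw_mult_mod_unit_group[OF n h]])
        also have "\<dots> = 0"
          using f unfolding W_def by blast
        finally show ?thesis .
      qed
      moreover have "f (h * a) = f (h * b)" if "[a = b] (mod int n)" for a b
        using that by (intro fcong cong_scalar_left)
      moreover have "f (h * a) = 0" if "\<not> coprime a (int n)" for a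
        using that f by (auto simp: W_def)
      moreover have "f (h * - a) = - f (h * a)" for a
        using f by (simp add: W_def)
      ultimately show ?thesis
        unfolding W_def by blast
    qed
  qed (use n \<open>F \<in> W\<close> \<open>F a \<noteq> 0\<close> in auto)
  interpret dirichlet_character n chi by (rule chi)
  have "chi (-1) = -1"
    using chi(2) one by (simp add: W_def)
  from odd_bernoulli_sum_nonzero[OF this] show False
    using chi(2) unfolding W_def by blast
qed

subsection \<open>Linear algebra\<close>

lemma sum_fun_apply: "(\<Sum>i\<in>I. f i) x = (\<Sum>i\<in>I. f i x)"
  by (induction I rule: infinite_finite_induct) auto

text \<open>Evaluation at \<open>e j\<close> extracts the coefficient of \<open>v j\<close>. It
  serves functionals, with basis vectors as points, as well as elements of the group algebra, with
  group elements as points.\<close>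

lemma cfun_independent_biorthogonal:
  fixes v :: "'i \<Rightarrow> 'a \<Rightarrow> complex" and e :: "'i \<Rightarrow> 'a"
  assumes fin: "finite I"
    and bi: "\<And>i j. i \<in> I \<Longrightarrow> j \<in> I \<Longrightarrow> v i (e j) = (if i = j then 1 else 0)"
  shows "inj_on v I" and "cfun.independent (v ` I)"
proof -
  show inj: "inj_on v I"
  proof
    fix i j assume ij: "i \<in> I" "j \<in> I" "v i = v j"
    have "(if j = i then 1 else 0 :: complex) = 1"
      using bi[OF ij(1) ij(1)] bi[OF ij(2) ij(1)] unfolding ij(3) by (simp only: if_True simp_thms)
    then show "i = j"
      by (simp split: if_splits)
  qed
  show "cfun.independent (v ` I)"
  proof
    assume "cfun.dependent (v ` I)"
    then obtain c w where w: "w \<in> v ` I" "c w \<noteq> 0" and sum: "(\<Sum>w\<in>v ` I. cscale (c w) w) = 0"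
      using cfun.dependent_finite[of "v ` I"] fin by auto
    then obtain j where j: "j \<in> I" "w = v j" by auto
    have "0 = (\<Sum>w\<in>v ` I. cscale (c w) w) (e j)"
      by (simp add: sum)
    also have "\<dots> = (\<Sum>i\<in>I. c (v i) * v i (e j))"
      by (simp add: sum.reindex[OF inj] sum_fun_apply cscale_def)
    also have "\<dots> = (\<Sum>i\<in>I. if i = j then c (v i) else 0)"
      using bi j(1) by (intro sum.cong) auto
    also have "\<dots> = c w"
      using fin j by simp
    finally show False using w by simp
  qed
qed

text \<open>A basis of \<open>V\<close> stays independent when \<open>a\<close> is added, so the
  values 0 on the basis and 1 at \<open>a\<close> extend linearly. The ambient space of all
  functions need not be finite-dimensional.\<close>

lemma separating_functional:
  fixes a :: "'a \<Rightarrow> complex"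
  assumes V: "cfun.subspace V" and a: "a \<notin> V"
  shows "\<exists>f. (\<forall>x y. f (x + y) = f x + f y) \<and> (\<forall>c x. f (cscale c x) = c * f x)
    \<and> (\<forall>x\<in>V. f x = 0) \<and> f a = (1::complex)"
proof -
  interpret pair: vector_space_pair cscale "(*) :: complex \<Rightarrow> complex \<Rightarrow> complex"
    by unfold_locales (auto simp: algebra_simps)
  obtain B where B: "B \<subseteq> V" "cfun.independent B" "V \<subseteq> cfun.span B"
    using cfun.maximal_independent_subset[of V] by blast
  have span: "cfun.span B = V"
    using B V by (metis cfun.span_minimal subset_antisym)
  then have "cfun.independent (insert a B)"
    using a B(2) by (simp add: cfun.independent_insertI)
  then obtain f where f: "Vector_Spaces.linear cscale (*) f"
    and f_eq: "\<forall>x\<in>insert a B. f x = (if x = a then 1 else 0 :: complex)"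
    using pair.linear_independent_extend[of "insert a B" "\<lambda>x. if x = a then 1 else 0"] by blast
  interpret f: Vector_Spaces.linear cscale "(*)" f by (rule f)
  have "f x = 0" if "x \<in> V" for x
  proof -
    have "x \<in> cfun.span B" using that span by simp
    moreover have "f y = 0" if "y \<in> B" for y
      using f_eq that a B(1) by auto
    ultimately show ?thesis
      by (rule f.eq_0_on_span[rotated])
  qed
  then show ?thesis
    using f.add f.scale f_eq by (intro exI[of _ f]) auto
qed

lemma bernoulli1_minus: "bernoulli1 (- x) = - bernoulli1 x"
proof (cases "x \<in> \<int>")
  case True
  then show ?thesis by (simp add: bernoulli1_def)
next
  case False
  then show ?thesis by (simp add: bernoulli1_def frac_neg)
qed

lemma group_algebra_subspace: "cfun.subspace (group_algebra n)"
  by (rule cfun.subspaceI) (auto simp: group_algebra_def cscale_def)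

lemma annihilator_subspace: "cfun.subspace (annihilator n V)"
proof (rule cfun.subspaceI)
  show "0 \<in> annihilator n V"
    by (auto simp: annihilator_def dual_space_def)
  show "f + g \<in> annihilator n V" if "f \<in> annihilator n V" "g \<in> annihilator n V" for f g
    using that by (auto simp: annihilator_def dual_space_def algebra_simps)
  show "cscale c f \<in> annihilator n V" if "f \<in> annihilator n V" for c f
    using that by (auto simp: annihilator_def dual_space_def cscale_def algebra_simps)
qed

section \<open>The odd part of the group algebra and its annihilator\<close>

locale modulus =
  fixes n :: nat
  assumes n_gt_2: "n > 2"
begin

abbreviation "U \<equiv> unit_group n"

text \<open>Representatives of the unit group modulo sign.\<close>

definition half_system :: "int set" where
  "half_system = {g \<in> U. 2 * g < int n}"

lemma n_gt_1: "n > 1"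
  using n_gt_2 by simp

lemma U_eq: "U = {x. 0 < x \<and> x < int n \<and> coprime x (int n)}"
  by (rule unit_group_eq[OF n_gt_1])

lemma finite_U: "finite U"
  by (rule finite_unit_group[OF n_gt_1])

lemma finite_half_system: "finite half_system"
  unfolding half_system_def using finite_U by simp

lemma minus_mod_U: "g \<in> U \<Longrightarrow> (- g) mod int n = int n - g"
  by (auto simp: U_eq zmod_zminus1_eq_if)

lemma neg_in_U:
  assumes "g \<in> U"
  shows "int n - g \<in> U"
proof -
  have "coprime (- g) (int n)"
    using assms by (simp add: U_eq)
  from mod_in_unit_group[OF n_gt_1 this] show ?thesis
    using minus_mod_U[OF assms] by simp
qed

lemma neg_res: "g \<in> U \<Longrightarrow> \<ominus>\<^bsub>residue_ring (int n)\<^esub> g = int n - g"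
proof -
  assume g: "g \<in> U"
  interpret residues "int n" "residue_ring (int n)"
    using n_gt_1 by unfold_locales auto
  show ?thesis
    using minus_mod_U[OF g] by (simp add: res_neg_eq)
qed

text \<open>Such a \<open>g\<close> would divide \<open>n\<close> and be coprime to it, hence be 1,
  and \<open>n\<close> would be 2. So negation has no fixed point on the units; the bound 2 on
  \<open>n\<close> enters here.\<close>

lemma double_neq:
  assumes "g \<in> U"
  shows "2 * g \<noteq> int n"
proof
  assume eq: "2 * g = int n"
  then have "g dvd int n" by (metis dvd_triv_right)
  moreover have "coprime g (int n)" using assms by (simp add: U_eq)
  ultimately have "is_unit g" by (metis coprime_absorb_left)
  then have "g = 1" using assms by (simp add: U_eq)
  then show False using eq n_gt_2 by simp
qed

lemma bij_neg_U: "bij_betw (\<lambda>g. int n - g) U U"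
  by (rule bij_betwI[of _ _ _ "\<lambda>g. int n - g"]) (auto intro: neg_in_U)

lemma sum_neg_U: "(\<Sum>g\<in>U. f (int n - g)) = (\<Sum>g\<in>U. f g)"
  by (rule sum.reindex_bij_betw[OF bij_neg_U])

lemma U_split: "U = half_system \<union> (\<lambda>g. int n - g) ` half_system"
proof (intro equalityI subsetI)
  fix g assume g: "g \<in> U"
  show "g \<in> half_system \<union> (\<lambda>g. int n - g) ` half_system"
  proof (cases "2 * g < int n")
    case False
    then have "int n - g \<in> half_system"
      using g neg_in_U[OF g] double_neq[OF g] by (auto simp: half_system_def)
    then show ?thesis by (auto intro: image_eqI[of _ _ "int n - g"])
  qed (use g in \<open>auto simp: half_system_def\<close>)
qed (auto simp: half_system_def intro: neg_in_U)

lemma card_half_system: "2 * card half_system = totient n"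
proof -
  interpret residues "int n" "residue_ring (int n)"
    using n_gt_1 by unfold_locales auto
  have "totient n = card U"
    using totient_eq by (simp add: unit_group_def)
  also have "card U = card half_system + card ((\<lambda>g. int n - g) ` half_system)"
    using finite_half_system
    by (subst U_split, intro card_Un_disjoint) (auto simp: half_system_def)
  also have "card ((\<lambda>g. int n - g) ` half_system) = card half_system"
    by (rule card_image) (auto simp: inj_on_def)
  finally show ?thesis by simp
qed

text \<open>The eigenspace of multiplication by the basis element of -1 for the eigenvalue -1; on
  the chosen representatives -g is \<open>int n - g\<close>.\<close>

definition odd_part :: "(int \<Rightarrow> complex) set" where
  "odd_part = {a \<in> group_algebra n. \<forall>g\<in>U. a (int n - g) = - a g}"

lemma odd_part_subspace: "cfun.subspace odd_part"
  using cfun.subspace_add[OF group_algebra_subspace] cfun.subspace_scale[OF group_algebra_subspace]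
    cfun.subspace_0[OF group_algebra_subspace]
  by (intro cfun.subspaceI) (auto simp: odd_part_def cscale_def)

lemma u_dual_apply:
  assumes "g \<in> U"
  shows "u_dual n g a = (if a \<in> group_algebra n then a g + a (int n - g) else 0)"
  using assms by (simp add: u_dual_def sigma_dual_def neg_res)

lemma u_dual_neg:
  assumes "g \<in> U"
  shows "u_dual n (int n - g) = u_dual n g"
  using u_dual_apply[OF assms] u_dual_apply[OF neg_in_U[OF assms]] by (auto simp: fun_eq_iff)

lemma u_dual_image: "u_dual n ` U = u_dual n ` half_system"
proof -
  have "u_dual n ` (\<lambda>g. int n - g) ` half_system = u_dual n ` half_system"
    unfolding image_image by (rule image_cong) (auto simp: half_system_def u_dual_neg)
  then show ?thesis
    by (subst U_split) (simp only: image_Un Un_absorb)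
qed

lemma u_dual_independent:
  "inj_on (u_dual n) half_system" "cfun.independent (u_dual n ` half_system)"
proof -
  have "u_dual n g (Defs.sigma h) = (if g = h then 1 else 0)" if "g \<in> half_system" "h \<in> half_system" for g h
    using that sigma_in_group_algebra[of h n] u_dual_apply[of g "Defs.sigma h"]
    by (auto simp: half_system_def Defs.sigma_def)
  then show "inj_on (u_dual n) half_system" "cfun.independent (u_dual n ` half_system)"
    using cfun_independent_biorthogonal[OF finite_half_system, of "u_dual n" Defs.sigma] by auto
qed

lemma odd_basis:
  defines "d \<equiv> \<lambda>g. Defs.sigma g - Defs.sigma (int n - g)"
  shows "inj_on d half_system" "cfun.independent (d ` half_system)" "cfun.span (d ` half_system) = odd_part"
proof -
  have "d g h = (if g = h then 1 else 0)" if "g \<in> half_system" "h \<in> half_system" for g h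
    using that by (auto simp: half_system_def Defs.sigma_def d_def)
  then show "inj_on d half_system" "cfun.independent (d ` half_system)"
    using cfun_independent_biorthogonal[OF finite_half_system, of d "\<lambda>h. h"] by auto
  show "cfun.span (d ` half_system) = odd_part"
  proof (rule equalityI)
    have "d g \<in> odd_part" if "g \<in> half_system" for g
    proof -
      have g: "g \<in> U" using that by (simp add: half_system_def)
      then show ?thesis
        using neg_in_U[OF g] by (auto simp: odd_part_def d_def group_algebra_def Defs.sigma_def)
    qed
    then show "cfun.span (d ` half_system) \<subseteq> odd_part"
      by (intro cfun.span_minimal odd_part_subspace) auto
    show "odd_part \<subseteq> cfun.span (d ` half_system)"
    proof
      fix a assume a: "a \<in> odd_part"
      have "a = (\<Sum>g\<in>half_system. cscale (a g) (d g))"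
      proof
        fix h
        have sum: "(\<Sum>g\<in>half_system. cscale (a g) (d g)) h =
            (\<Sum>g\<in>half_system. if g = h then a g else 0) - (\<Sum>g\<in>half_system. if g = int n - h then a g else 0)"
          unfolding sum_fun_apply sum_subtractf[symmetric]
          by (intro sum.cong) (auto simp: cscale_def d_def Defs.sigma_def half_system_def)
        also have "\<dots> = (if h \<in> half_system then a h else 0) - (if int n - h \<in> half_system then a (int n - h) else 0)"
          using finite_half_system by simp
        \<comment> \<open>If \<open>h\<close> is a unit, exactly one of \<open>h\<close> and
          \<open>int n - h\<close> lies in \<open>half_system\<close>; otherwise neither
          does.\<close>
        also have "\<dots> = a h"
        proof (cases "h \<in> U")
          case True
          then show ?thesis
            using a neg_in_U[OF True] double_neq[OF True] by (auto simp: half_system_def odd_part_def)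
        next
          case False
          then have "int n - h \<notin> U" using neg_in_U[of "int n - h"] by auto
          then show ?thesis
            using False a by (auto simp: half_system_def odd_part_def group_algebra_def)
        qed
        finally show "a h = (\<Sum>g\<in>half_system. cscale (a g) (d g)) h" by simp
      qed
      also have "\<dots> \<in> cfun.span (d ` half_system)"
        by (intro cfun.span_sum cfun.span_scale cfun.span_base) auto
      finally show "a \<in> cfun.span (d ` half_system)" .
    qed
  qed
qed

lemma stickelberger_apply:
  "stickelberger n x g = (if g \<in> U then of_real (bernoulli1 (of_int g * x)) else 0)"
proof -
  have "stickelberger n x g = (\<Sum>h\<in>U. if h = g then of_real (bernoulli1 (of_int g * x)) else 0)"
    unfolding stickelberger_def sum_fun_apply by (intro sum.cong) (auto simp: cscale_def Defs.sigma_def)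
  then show ?thesis using finite_U by simp
qed

lemma stickelberger_span_subset_odd_part: "stickelberger_span n \<subseteq> odd_part"
  unfolding stickelberger_span_def
proof (intro cfun.span_minimal odd_part_subspace subsetI)
  fix s assume "s \<in> stickelberger n ` frac_multiples n"
  then obtain k :: int where s: "s = stickelberger n (of_int k / of_nat n)"
    by (auto simp: frac_multiples_def)
  have "s (int n - g) = - s g" if "g \<in> U" for g
  proof -
    have "of_int (int n - g) * (of_int k / real n) = - (of_int g * (of_int k / real n)) + of_int k"
      using n_gt_1 by (simp add: field_simps)
    then have "bernoulli1 (of_int (int n - g) * (of_int k / real n)) = - bernoulli1 (of_int g * (of_int k / real n))"
      by (simp only: bernoulli1_add_Ints[OF Ints_of_int] bernoulli1_minus)
    then show ?thesis
      using that neg_in_U[OF that] by (simp add: s stickelberger_apply)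
  qed
  then show "s \<in> odd_part"
    by (auto simp: odd_part_def group_algebra_def s stickelberger_apply)
qed

lemma dual_expand:
  assumes f: "f \<in> dual_space n" and a: "a \<in> group_algebra n"
  shows "f a = (\<Sum>g\<in>U. f (Defs.sigma g) * a g)"
proof -
  have add: "f (x + y) = f x + f y" if "x \<in> group_algebra n" "y \<in> group_algebra n" for x y
    using f that by (simp add: dual_space_def)
  have scale: "f (cscale c x) = c * f x" if "x \<in> group_algebra n" for c x
    using f that by (simp add: dual_space_def)
  have zero: "0 \<in> group_algebra n"
    using cfun.subspace_0[OF group_algebra_subspace] .
  have f0: "f 0 = 0"
    using add[OF zero zero] by simp
  \<comment> \<open>Additivity of \<open>f\<close> is available only inside the group algebra, so
    membership of the partial sums is carried through the induction.\<close>
  have key: "f (\<Sum>g\<in>S. cscale (a g) (Defs.sigma g)) = (\<Sum>g\<in>S. f (Defs.sigma g) * a g) \<and>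
      (\<Sum>g\<in>S. cscale (a g) (Defs.sigma g)) \<in> group_algebra n" if "finite S" "S \<subseteq> U" for S
    using that
  proof (induction S rule: finite_induct)
    case empty
    then show ?case using f0 zero by (simp only: sum.empty simp_thms)
  next
    case (insert g S)
    then have g: "Defs.sigma g \<in> group_algebra n" "cscale (a g) (Defs.sigma g) \<in> group_algebra n"
      using sigma_in_group_algebra[of g n] cfun.subspace_scale[OF group_algebra_subspace] by auto
    have IH: "f (\<Sum>g\<in>S. cscale (a g) (Defs.sigma g)) = (\<Sum>g\<in>S. f (Defs.sigma g) * a g)"
      "(\<Sum>g\<in>S. cscale (a g) (Defs.sigma g)) \<in> group_algebra n"
      using insert by auto
    show ?case
      unfolding sum.insert[OF insert.hyps]
      using add[OF g(2) IH(2)] scale[OF g(1)] IH(1)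
        cfun.subspace_add[OF group_algebra_subspace g(2) IH(2)]
      by (simp only: mult.commute simp_thms)
  qed
  have "a = (\<Sum>g\<in>U. cscale (a g) (Defs.sigma g))"
  proof
    fix h
    have "(\<Sum>g\<in>U. cscale (a g) (Defs.sigma g)) h = (\<Sum>g\<in>U. if g = h then a g else 0)"
      unfolding sum_fun_apply by (intro sum.cong) (auto simp: cscale_def Defs.sigma_def)
    then show "a h = (\<Sum>g\<in>U. cscale (a g) (Defs.sigma g)) h"
      using a finite_U by (simp add: group_algebra_def)
  qed
  then have "f a = f (\<Sum>g\<in>U. cscale (a g) (Defs.sigma g))"
    by (rule arg_cong)
  then show ?thesis
    using key[OF finite_U order_refl] by (simp only:)
qed

lemma u_dual_in_annihilator_odd_part:
  assumes "g \<in> U"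
  shows "u_dual n g \<in> annihilator n odd_part"
proof -
  have "u_dual n g \<in> dual_space n"
    using group_algebra_subspace
    by (auto simp: dual_space_def u_dual_apply[OF assms] cscale_def group_algebra_def algebra_simps)
  then show ?thesis
    using assms by (auto simp: annihilator_def odd_part_def u_dual_apply)
qed

lemma span_u_dual_subset: "cfun.span (u_dual n ` U) \<subseteq> annihilator n odd_part"
  by (intro cfun.span_minimal annihilator_subspace) (auto intro: u_dual_in_annihilator_odd_part)

text \<open>The function \<open>F\<close> is twice the odd part of the coefficients of
  \<open>f\<close>, extended by 0 to the integers. As each S(x) is odd, pairing \<open>F\<close>
  with it gives 2 f(S(x)) = 0, so \<open>odd_orthogonal_to_bernoulli_eq_0\<close> makes
  \<open>F\<close> vanish.\<close>

lemma annihilator_even: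
  assumes f: "f \<in> annihilator n (stickelberger_span n)" and g: "g \<in> U"
  shows "f (Defs.sigma (int n - g)) = f (Defs.sigma g)"
proof -
  define F where "F a = (if coprime a (int n) then f (Defs.sigma (a mod int n)) - f (Defs.sigma ((- a) mod int n)) else 0)" for a
  have dual: "f \<in> dual_space n"
    using f by (simp add: annihilator_def)
  have neg_mod: "(- h) mod int n = int n - h" "h mod int n = h" "coprime h (int n)" if "h \<in> U" for h
    using that minus_mod_U[OF that] by (auto simp: U_eq)
  have FU: "F h = f (Defs.sigma h) - f (Defs.sigma (int n - h))" if "h \<in> U" for h
    using neg_mod[OF that] by (simp add: F_def)
  have "F g = 0"
  proof (rule odd_orthogonal_to_bernoulli_eq_0[OF n_gt_1])
    show "F a = F b" if "[a = b] (mod int n)" for a b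
    proof -
      have "a mod int n = b mod int n" using that by (simp add: Cong.cong_def)
      moreover from this have "(- a) mod int n = (- b) mod int n" by (metis mod_minus_eq)
      moreover have "coprime a (int n) \<longleftrightarrow> coprime b (int n)"
        using that cong_imp_coprime cong_sym by blast
      ultimately show ?thesis by (simp add: F_def)
    qed
    show "F a = 0" if "\<not> coprime a (int n)" for a
      using that by (simp add: F_def)
    show "F (- a) = - F a" for a
      by (simp add: F_def)
    fix k :: int
    let ?B = "\<lambda>g. complex_of_real (bernoulli1 (of_int (g * k) / real n))"
    define s where "s = stickelberger n (of_int k / of_nat n)"
    have "s \<in> stickelberger_span n"
      unfolding stickelberger_span_def s_def by (intro cfun.span_base) (auto simp: frac_multiples_def)
    then have s: "f s = 0" "s \<in> odd_part"
      using f stickelberger_span_subset_odd_part by (auto simp: annihilator_def)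
    have sB: "s g = ?B g" if "g \<in> U" for g
      using that by (simp add: s_def stickelberger_apply)
    have "(\<Sum>g\<in>U. F g * ?B g) = (\<Sum>g\<in>U. f (Defs.sigma g) * s g) - (\<Sum>g\<in>U. f (Defs.sigma (int n - g)) * s g)"
      unfolding sum_subtractf[symmetric] by (intro sum.cong) (auto simp: FU sB algebra_simps)
    also have "(\<Sum>g\<in>U. f (Defs.sigma (int n - g)) * s g) = (\<Sum>g\<in>U. f (Defs.sigma (int n - g)) * - s (int n - g))"
      using s(2) by (intro sum.cong) (auto simp: odd_part_def)
    also have "\<dots> = (\<Sum>g\<in>U. f (Defs.sigma g) * - s g)"
      by (rule sum_neg_U)
    also have "(\<Sum>g\<in>U. f (Defs.sigma g) * s g) - (\<Sum>g\<in>U. f (Defs.sigma g) * - s g) = 2 * (\<Sum>g\<in>U. f (Defs.sigma g) * s g)"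
      by (simp add: sum_negf)
    also have "(\<Sum>g\<in>U. f (Defs.sigma g) * s g) = f s"
      using dual_expand[OF dual, of s] s(2) by (simp add: odd_part_def)
    finally show "(\<Sum>g\<in>U. F g * ?B g) = 0"
      using s(1) by simp
  qed
  then show ?thesis
    using FU[OF g] by simp
qed

lemma annihilator_subset_span_u_dual:
  "annihilator n (stickelberger_span n) \<subseteq> cfun.span (u_dual n ` U)"
proof
  fix f assume f: "f \<in> annihilator n (stickelberger_span n)"
  then have dual: "f \<in> dual_space n"
    by (simp add: annihilator_def)
  \<comment> \<open>The factor 1/2 compensates that the sum over all units meets each functional
    \<open>u_dual n g\<close> twice, at \<open>g\<close> and at its negative.\<close>
  have "f = (\<Sum>g\<in>U. cscale (f (Defs.sigma g) / 2) (u_dual n g))"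
  proof
    fix a
    have eq: "(\<Sum>g\<in>U. cscale (f (Defs.sigma g) / 2) (u_dual n g)) a = (\<Sum>g\<in>U. f (Defs.sigma g) / 2 * u_dual n g a)"
      by (simp add: sum_fun_apply cscale_def)
    show "f a = (\<Sum>g\<in>U. cscale (f (Defs.sigma g) / 2) (u_dual n g)) a"
    proof (cases "a \<in> group_algebra n")
      case True
      have "(\<Sum>g\<in>U. f (Defs.sigma g) / 2 * u_dual n g a) =
          (\<Sum>g\<in>U. f (Defs.sigma g) * a g / 2) + (\<Sum>g\<in>U. f (Defs.sigma (int n - g)) * a (int n - g) / 2)"
        unfolding sum.distrib[symmetric] using True annihilator_even[OF f]
        by (intro sum.cong) (auto simp: u_dual_apply field_simps)
      also have "(\<Sum>g\<in>U. f (Defs.sigma (int n - g)) * a (int n - g) / 2) = (\<Sum>g\<in>U. f (Defs.sigma g) * a g / 2)"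
        by (rule sum_neg_U)
      also have "(\<Sum>g\<in>U. f (Defs.sigma g) * a g / 2) + \<dots> = f a"
        unfolding dual_expand[OF dual True] by (simp flip: sum_divide_distrib)
      finally show ?thesis
        using eq by simp
    next
      case False
      then show ?thesis
        unfolding eq using dual by (simp add: u_dual_apply dual_space_def)
    qed
  qed
  also have "\<dots> \<in> cfun.span (u_dual n ` U)"
    by (intro cfun.span_sum cfun.span_scale cfun.span_base) auto
  finally show "f \<in> cfun.span (u_dual n ` U)" .
qed

lemma span_u_dual: "cfun.span (u_dual n ` U) = annihilator n (stickelberger_span n)"
proof (rule equalityI[OF _ annihilator_subset_span_u_dual])
  show "cfun.span (u_dual n ` U) \<subseteq> annihilator n (stickelberger_span n)"
    using span_u_dual_subset stickelberger_span_subset_odd_part by (auto simp: annihilator_def)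
qed

text \<open>An odd element outside the span could be separated from it by a functional vanishing on
  the span. Such a functional is a combination of the \<open>u_dual n g\<close>, all of which vanish
  on odd elements.\<close>

lemma stickelberger_span_eq_odd_part: "stickelberger_span n = odd_part"
proof (rule equalityI[OF stickelberger_span_subset_odd_part], rule subsetI, rule ccontr)
  fix a assume a: "a \<in> odd_part" "a \<notin> stickelberger_span n"
  have "cfun.subspace (stickelberger_span n)"
    by (simp add: stickelberger_span_def)
  from separating_functional[OF this a(2)] obtain f :: "(int \<Rightarrow> complex) \<Rightarrow> complex" where
    f: "(\<forall>x y. f (x + y) = f x + f y) \<and> (\<forall>c x. f (cscale c x) = c * f x)
      \<and> (\<forall>x\<in>stickelberger_span n. f x = 0) \<and> f a = 1"
    by (rule exE)
  \<comment> \<open>Members of \<open>dual_space\<close> are 0 outside the group algebra, so the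
    separating functional is cut off there.\<close>
  define f' where "f' x = (if x \<in> group_algebra n then f x else 0)" for x
  have "f' \<in> dual_space n"
    using f cfun.subspace_add[OF group_algebra_subspace] cfun.subspace_scale[OF group_algebra_subspace]
    by (auto simp: dual_space_def f'_def)
  then have "f' \<in> annihilator n (stickelberger_span n)"
    using f by (auto simp: annihilator_def f'_def)
  then have "f' \<in> annihilator n odd_part"
    using annihilator_subset_span_u_dual span_u_dual_subset by blast
  then have "f' a = 0"
    using a(1) by (simp add: annihilator_def)
  then show False
    using a(1) f by (simp add: f'_def odd_part_def)
qed

end

theorem theorem3p1:
  fixes n :: nat
  assumes "n > 2"
  shows "cfun.independent (u_dual n ` unit_group n)
    \<and> cfun.span (u_dual n ` unit_group n) = annihilator n (stickelberger_span n)
    \<and> real (cfun.dim (annihilator n (stickelberger_span n))) = real (totient n) / 2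
    \<and> real (cfun.dim (stickelberger_span n)) = real (totient n) / 2"
proof -
  interpret modulus n
    using assms by unfold_locales
  have card: "real (card half_system) = real (totient n) / 2"
    using card_half_system by linarith
  \<comment> \<open>Independence refers to the image as a set, in which the functionals of
    \<open>g\<close> and its negative coincide; the half system already yields all of it.\<close>
  have indep: "cfun.independent (u_dual n ` U)"
    unfolding u_dual_image by (rule u_dual_independent)
  have "cfun.dim (annihilator n (stickelberger_span n)) = card (u_dual n ` U)"
    using cfun.dim_span_eq_card_independent[OF indep] by (simp only: span_u_dual)
  also have "\<dots> = card half_system"
    unfolding u_dual_image by (rule card_image[OF u_dual_independent(1)])
  finally have dim1: "cfun.dim (annihilator n (stickelberger_span n)) = card half_system" .
  have "cfun.dim (stickelberger_span n) = card ((\<lambda>g. Defs.sigma g - Defs.sigma (int n - g)) ` half_system)"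
    using cfun.dim_span_eq_card_independent[OF odd_basis(2)]
    by (simp only: odd_basis(3) stickelberger_span_eq_odd_part)
  also have "\<dots> = card half_system"
    by (rule card_image[OF odd_basis(1)])
  finally show ?thesis
    using indep span_u_dual dim1 card by simp
qed

end
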